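(* Let $(\mathcal{X},p_X)$ be a discrete memoryless source with finite alphabet and unknown distribution $p_X$, and let $(\mathcal{Y},p_Y)$ be a discrete memoryless source with finite alphabet and known distribution $p_Y$, with $H(Y)>0$. For universal covertness for $(\mathcal{X},p_X)$ with respect to $(\mathcal{Y},p_Y)$, the asymptotic rate $\operatorname{p-lim}_{n\to\infty} m(X^n)/n \leq H(X)/H(Y)$ (which is attained by some sequence of universal covert source codes) is optimal: every achievable rate $R$ satisfies $$R \geq \frac{H(X)}{H(Y)}.$$
   Context: $X^n$ is a sequence of $n$ i.i.d. symbols with distribution $p_X$. $H(X)$ and $H(Y)$ are the Shannon entropies of $p_X$ and $p_Y$. $\mathbb{D}(p\Vert q)$ is the Kullback-Leibler divergence (equal to $+\infty$ if $p(x)>0=q(x)$ for some $x$). $\operatorname{p-lim}$ and $\operatorname{p-lim\,sup}$ denote limit and limit superior in probability. An $(n,2^{d_n})$ variable-length universal covert source code for $(\mathcal{X},p_X)$ with respect to $(\mathcal{Y},p_Y)$ consists of: - a seed $U_{d_n}$ (of length $d_n$), chosen uniformly at random in $\mathcal{U}_{d_n}=\{1,\dots,2^{d_n}\}$, independent of all other random variables, and shared by encoder and decoder; - an encoding function $\phi_n:\mathcal{X}^n\times\mathcal{U}_{d_n}\to\mathcal{Y}^m$ that takes as input the seed $U_{d_n}$ and the sequence $X^n$ emitted by $(\mathcal{X},p_X)$; - a decoding function $\psi_n:\mathcal{Y}^m\times\mathcal{U}_{d_n}\to\mathcal{X}^n$. The distribution $p_X$ is unknown, so $\phi_n$ and $\psi_n$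 do not depend on prior knowledge about $p_X$, but they may depend on the specific realization of the source sequence: the code has variable length, and $m=m(X^n)$ is a random variable that is a function of $X^n$. A rate $R$ is achievable if there exists a sequence of $(n,2^{d_n})$ variable-length universal covert source codes such that (a) $\operatorname{p-lim\,sup}_{n\to\infty} m(X^n)/n\leq R$; (b) $\lim_{n\to\infty} d_n/n=0$; (c) $\lim_{n\to\infty}\mathbb{P}[X^n\neq\psi_n(\phi_n(X^n,U_{d_n}),U_{d_n})]=0$; (d) $\lim_{n\to\infty}\mathbb{D}\big(p_{\phi_n(X^n,U_{d_n})}\Vert p_Y^{\otimes m(X^n)}\big)=0$. Here $p_{\phi_n(X^n,U_{d_n})}$ is the distribution of the encoder output and $p_Y^{\otimes m(X^n)}=\prod_{i=1}^{m(X^n)}p_Y$. The divergence in (d) is a random variable, since the length $m(X^n)$ of the encoder output is itself a random variable. *)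

theory Defs
  imports "HOL-Probability.Probability"
begin

section \<open>Information measures of discrete distributions, in bits\<close>

definition shannon_entropy :: "'a::finite pmf \<Rightarrow> real" where
  "shannon_entropy p = prob_space.entropy (measure_pmf p) 2 (count_space UNIV) (\<lambda>x. x)"

text \<open>
  The library function takes the reference measure first, and is real-valued: it is only meaningful
  under absolute continuity, so the value \<open>\<infinity>\<close> is added here.
\<close>
definition KL_div :: "'a pmf \<Rightarrow> 'a pmf \<Rightarrow> ereal" where
  "KL_div p q =
     (if set_pmf p \<subseteq> set_pmf q
      then ereal (KL_divergence 2 (measure_pmf q) (measure_pmf p)) else \<infinity>)"

lemma shannon_entropy_eq_sum: "shannon_entropy p = - (\<Sum>x\<in>UNIV. pmf p x * log 2 (pmf p x))"
proof -
  interpret information_space "measure_pmf p" 2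
    by unfold_locales simp
  have "simple_distributed (measure_pmf p) (\<lambda>x. x) (pmf p)"
    by (rule measure_pmf.simple_distributedI) (auto simp: simple_function_def pmf.rep_eq vimage_def)
  then have "prob_space.entropy (measure_pmf p) 2 (count_space ((\<lambda>x. x) ` space (measure_pmf p))) (\<lambda>x. x) =
      - (\<Sum>x\<in>(\<lambda>x. x) ` space (measure_pmf p). pmf p x * log 2 (pmf p x))"
    by (rule entropy_simple_distributed)
  then show ?thesis
    by (simp add: shannon_entropy_def)
qed

lemma KL_div_eq_sum:
  fixes p q :: "'a::countable pmf"
  assumes "finite (set_pmf p)" "set_pmf p \<subseteq> set_pmf q"
  shows "KL_div p q = ereal (\<Sum>x\<in>set_pmf p. pmf p x * log 2 (pmf p x / pmf q x))"
proof -
  interpret sigma_finite_measure "count_space (UNIV :: 'a set)"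
    by (rule sigma_finite_measure_count_space_countable) simp
  have "KL_divergence 2 (measure_pmf q) (measure_pmf p) =
      (\<integral>x. pmf p x * log 2 (pmf p x / pmf q x) \<partial>count_space UNIV)"
    unfolding measure_pmf_eq_density using assms(2)
    by (intro KL_density_density) (auto simp: AE_count_space set_pmf_iff)
  also have "\<dots> = (\<Sum>x | pmf p x * log 2 (pmf p x / pmf q x) \<noteq> 0.
      pmf p x * log 2 (pmf p x / pmf q x))"
    by (subst lebesgue_integral_count_space_finite_support)
      (auto simp: set_pmf_iff intro: finite_subset[OF _ assms(1)])
  also have "\<dots> = (\<Sum>x\<in>set_pmf p. pmf p x * log 2 (pmf p x / pmf q x))"
    using assms(1) by (intro sum.mono_neutral_left) (auto simp: set_pmf_iff)
  finally show ?thesis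
    using assms(2) by (simp add: KL_div_def)
qed

section \<open>Limits in probability\<close>

text \<open>
  The \<open>n\<close>-th random variable \<open>Z n\<close> lives on its own probability space \<open>P n\<close>; both notions depend
  only on the individual laws.
\<close>
definition p_lim :: "(nat \<Rightarrow> 'a pmf) \<Rightarrow> (nat \<Rightarrow> 'a \<Rightarrow> 'b::topological_space) \<Rightarrow> 'b \<Rightarrow> bool" where
  "p_lim P Z L \<longleftrightarrow>
     (\<forall>S. open S \<longrightarrow> L \<in> S \<longrightarrow> (\<lambda>n. measure_pmf.prob (P n) {w. Z n w \<notin> S}) \<longlonglongrightarrow> 0)"

definition p_limsup :: "(nat \<Rightarrow> 'a pmf) \<Rightarrow> (nat \<Rightarrow> 'a \<Rightarrow> real) \<Rightarrow> ereal" where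
  "p_limsup P Z =
     Inf {ereal a | a. (\<lambda>n. measure_pmf.prob (P n) {w. Z n w > a}) \<longlonglongrightarrow> 0}"

section \<open>Variable-length universal covert source codes\<close>

text \<open>
  Words are lists. The output length depends on the source word only, not on the seed. The decoder
  knows the output length as the length of its input.
\<close>
record ('x, 'y) covert_code =
  seed_length :: nat
  out_length :: "'x list \<Rightarrow> nat"
  encode :: "'x list \<Rightarrow> nat \<Rightarrow> 'y list"
  decode :: "'y list \<Rightarrow> nat \<Rightarrow> 'x list"

definition seeds :: "('x, 'y) covert_code \<Rightarrow> nat set" where
  "seeds C = {1..2 ^ seed_length C}"

definition is_code :: "nat \<Rightarrow> ('x, 'y) covert_code \<Rightarrow> bool" where
  "is_code n C \<longleftrightarrow>
     (\<forall>x u. length x = n \<longrightarrow> u \<in> seeds C \<longrightarrow> length (encode C x u) = out_length C x) \<and>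
     (\<forall>y u. u \<in> seeds C \<longrightarrow> length (decode C y u) = n)"

definition source_seed_pmf ::
  "nat \<Rightarrow> 'x pmf \<Rightarrow> ('x, 'y) covert_code \<Rightarrow> ('x list \<times> nat) pmf" where
  "source_seed_pmf n pX C = pair_pmf (replicate_pmf n pX) (pmf_of_set (seeds C))"

definition error_prob :: "nat \<Rightarrow> 'x pmf \<Rightarrow> ('x, 'y) covert_code \<Rightarrow> real" where
  "error_prob n pX C =
     measure_pmf.prob (source_seed_pmf n pX C) {(x, u). x \<noteq> decode C (encode C x u) u}"

text \<open>
  The law of the encoder output given that its length is \<open>k\<close>; it is used only for lengths \<open>k\<close> of
  positive probability, where the conditioning is defined.
\<close>
definition output_pmf ::
  "nat \<Rightarrow> 'x pmf \<Rightarrow> ('x, 'y) covert_code \<Rightarrow> nat \<Rightarrow> 'y list pmf" where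
  "output_pmf n pX C k =
     map_pmf (\<lambda>(x, u). encode C x u)
       (cond_pmf (source_seed_pmf n pX C) {(x, u). out_length C x = k})"

text \<open>
  The divergence as a random variable: a function of the source word through the realized length.
  The conditional law is compared with the product law because the two distributions must live
  on words of the same length; the unconditional output law has infinite divergence from the
  product law on words of length \<open>k\<close> as soon as another length has positive probability.
\<close>
definition covertness ::
  "nat \<Rightarrow> 'x pmf \<Rightarrow> 'y pmf \<Rightarrow> ('x, 'y) covert_code \<Rightarrow> 'x list \<Rightarrow> ereal" where
  "covertness n pX pY C x =
     KL_div (output_pmf n pX C (out_length C x)) (replicate_pmf (out_length C x) pY)"

definition length_rate :: "(nat \<Rightarrow> ('x, 'y) covert_code) \<Rightarrow> nat \<Rightarrow> 'x list \<Rightarrow> real" where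
  "length_rate C n x = real (out_length (C n) x) / real n"

text \<open>
  The source distribution is unknown: one and the same sequence of codes has to be reliable and
  covert whatever the source distribution is.
\<close>
definition universal_covert :: "'y pmf \<Rightarrow> (nat \<Rightarrow> ('x, 'y) covert_code) \<Rightarrow> bool" where
  "universal_covert pY C \<longleftrightarrow>
     (\<forall>n. is_code n (C n)) \<and>
     (\<lambda>n. real (seed_length (C n)) / real n) \<longlonglongrightarrow> 0 \<and>
     (\<forall>p. (\<lambda>n. error_prob n p (C n)) \<longlonglongrightarrow> 0 \<and>
          p_lim (\<lambda>n. replicate_pmf n p) (\<lambda>n. covertness n p pY (C n)) 0)"

definition achievable :: "'x pmf \<Rightarrow> 'y pmf \<Rightarrow> real \<Rightarrow> bool" where
  "achievable pX pY R \<longleftrightarrow>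
     (\<exists>C :: nat \<Rightarrow> ('x, 'y) covert_code. universal_covert pY C \<and>
        p_limsup (\<lambda>n. replicate_pmf n pX) (length_rate C) \<le> ereal R)"

end

theory Submission
  imports Defs "HOL-Real_Asymp.Real_Asymp" "HOL-Combinatorics.Multiset_Permutations"
begin

text \<open>
  Achievability. Given its type (the multiset of its letters), a source word is uniformly
  distributed on its type class, whatever the source distribution is. Hence it suffices to turn a
  uniform message from \<open>{..<M}\<close> and a uniform seed from \<open>{..<2 ^ b}\<close> into a word of length about
  \<open>log M / H(Y)\<close> whose law is at most \<open>1 + \<epsilon>\<close> times the product law, such that the seed makes the
  map invertible. For this the \<open>M * 2 ^ b\<close> pairs, in lexicographic order, are distributed over the
  typical words, each word receiving a run of at most \<open>2 ^ b\<close> consecutive pairs. Two such blocks are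
  concatenated: the type, which is made uniform by a one-time pad taken from the seed, and the
  position in the type class. There are only polynomially many types, so the first block is short,
  and a type class has at most \<open>1 / p(x)\<close> elements, so the second one has length about
  \<open>n H(X) / H(Y)\<close>.

  Converse. Covertness forces the output into the set of typical words, and for each seed the
  decodable source words with outputs of length at most \<open>a n\<close> are at most as many as the typical
  words of these lengths, about \<open>2 powr (a n H(Y))\<close>. If \<open>a H(Y) < H(X)\<close>, so few source words have
  vanishing probability. This also shows that the length of the above code does not fall
  below \<open>n H(X) / H(Y)\<close>.
\<close>

section \<open>Product laws\<close>

lemma finite_words: "finite {xs :: 'a::finite list. length xs = n}"
  using finite_lists_length_eq[of "UNIV :: 'a set" n] by simp

lemma pmf_replicate_pmf:
  "pmf (replicate_pmf n p) xs = (if length xs = n then prod_list (map (pmf p) xs) else 0)"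
proof (induction n arbitrary: xs)
  case 0
  then show ?case by (auto simp: indicator_def)
next
  case (Suc n)
  have eq: "replicate_pmf (Suc n) p = map_pmf (\<lambda>(x, y). x # y) (pair_pmf p (replicate_pmf n p))"
    by (simp add: pair_pmf_def map_pmf_def bind_assoc_pmf bind_return_pmf)
  show ?case
  proof (cases xs)
    case Nil
    have "[] \<notin> set_pmf (replicate_pmf (Suc n) p)" by (simp add: set_replicate_pmf)
    then show ?thesis using Nil by (simp add: set_pmf_iff del: replicate_pmf.simps)
  next
    case (Cons a ys)
    have inj: "inj (\<lambda>(x, y). x # y)" by (auto simp: inj_on_def)
    have "pmf (replicate_pmf (Suc n) p) (a # ys) = pmf (pair_pmf p (replicate_pmf n p)) (a, ys)"
      unfolding eq using pmf_map_inj'[OF inj, of _ "(a, ys)"] by simp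
    also have "\<dots> = pmf p a * pmf (replicate_pmf n p) ys" by (simp add: pmf_pair)
    finally show ?thesis using Cons Suc by (simp del: replicate_pmf.simps)
  qed
qed

text \<open>Lets the bounds for two concatenated blocks multiply to a bound for the whole output
  word.\<close>

lemma pmf_replicate_pmf_append:
  "pmf (replicate_pmf (length xs) p) xs * pmf (replicate_pmf (length ys) p) ys =
     pmf (replicate_pmf (length xs + length ys) p) (xs @ ys)"
  by (simp add: pmf_replicate_pmf)

lemma pmf_replicate_pmf_mset:
  "mset xs = mset ys \<Longrightarrow> pmf (replicate_pmf n p) xs = pmf (replicate_pmf n p) ys"
proof -
  assume m: "mset xs = mset ys"
  then have "length xs = length ys" by (metis size_mset)
  moreover have "prod_mset (mset (map (pmf p) xs)) = prod_mset (mset (map (pmf p) ys))"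
    using m by simp
  ultimately show ?thesis by (simp add: pmf_replicate_pmf flip: prod_mset_prod_list)
qed

lemma sum_pmf_words: "(\<Sum>xs | length xs = n. pmf (replicate_pmf n p) (xs :: 'a::finite list)) = 1"
  by (rule sum_pmf_eq_1) (auto simp: finite_words set_replicate_pmf)

lemma prob_words:
  "measure_pmf.prob (replicate_pmf n p) A =
     (\<Sum>xs | length xs = n \<and> xs \<in> A. pmf (replicate_pmf n p) (xs :: 'a::finite list))"
proof -
  have "measure_pmf.prob (replicate_pmf n p) A =
      measure_pmf.prob (replicate_pmf n p) {xs. length xs = n \<and> xs \<in> A}"
    by (rule measure_pmf.finite_measure_eq_AE) (auto simp: AE_measure_pmf_iff set_replicate_pmf)
  also have "\<dots> = (\<Sum>xs | length xs = n \<and> xs \<in> A. pmf (replicate_pmf n p) xs)"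
    by (rule measure_measure_pmf_finite) (auto intro: finite_subset[OF _ finite_words])
  finally show ?thesis .
qed

lemma sum_words_Suc:
  "(\<Sum>xs | length xs = Suc n. f (xs :: 'a::finite list)) = (\<Sum>x\<in>UNIV. \<Sum>xs | length xs = n. f (x # xs))"
proof -
  have "{xs :: 'a list. length xs = Suc n} = (\<lambda>(x, xs). x # xs) ` (UNIV \<times> {xs. length xs = n})"
    by (force simp: length_Suc_conv image_iff)
  then have "(\<Sum>xs | length xs = Suc n. f xs) = (\<Sum>(x, xs)\<in>UNIV \<times> {xs. length xs = n}. f (x # xs))"
    by (simp add: sum.reindex inj_on_def case_prod_unfold)
  then show ?thesis by (simp add: sum.cartesian_product)
qed

section \<open>Chebyshev's inequality for sums over i.i.d. letters\<close>

text \<open>Induction on the first letter: its square contributes one variance, and the cross term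
  vanishes because the sum over the remaining letters has mean zero (\<open>m1\<close>).\<close>

lemma second_moment_words:
  fixes f :: "'a::finite \<Rightarrow> real"
  assumes "(\<Sum>x\<in>UNIV. pmf p x * f x) = 0"
  shows "(\<Sum>xs | length xs = n. pmf (replicate_pmf n p) xs * (sum_list (map f xs))\<^sup>2) =
           n * (\<Sum>x\<in>UNIV. pmf p x * (f x)\<^sup>2)"
proof -
  have one: "(\<Sum>x\<in>UNIV. pmf p x) = 1" by (rule sum_pmf_eq_1) auto
  have cons: "length xs = n \<Longrightarrow> pmf (replicate_pmf (Suc n) p) (x # xs) =
      pmf p x * pmf (replicate_pmf n p) xs" for x xs n
    by (simp add: pmf_replicate_pmf del: replicate_pmf.simps)
  have m1: "(\<Sum>xs | length xs = n. pmf (replicate_pmf n p) xs * sum_list (map f xs)) = 0" for n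
  proof (induction n)
    case (Suc n)
    have "(\<Sum>xs | length xs = Suc n. pmf (replicate_pmf (Suc n) p) xs * sum_list (map f xs)) =
        (\<Sum>x\<in>UNIV. \<Sum>xs | length xs = n. (pmf p x * f x) * pmf (replicate_pmf n p) xs +
           pmf p x * (pmf (replicate_pmf n p) xs * sum_list (map f xs)))"
      unfolding sum_words_Suc
      by (intro sum.cong refl) (simp add: cons algebra_simps del: replicate_pmf.simps)
    also have "\<dots> = 0"
      by (simp add: sum.distrib sum_pmf_words Suc assms flip: sum_distrib_left sum_distrib_right)
    finally show ?case .
  qed simp
  show "(\<Sum>xs | length xs = n. pmf (replicate_pmf n p) xs * (sum_list (map f xs))\<^sup>2) =
           n * (\<Sum>x\<in>UNIV. pmf p x * (f x)\<^sup>2)"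
  proof (induction n)
    case (Suc n)
    have "(\<Sum>xs | length xs = Suc n. pmf (replicate_pmf (Suc n) p) xs * (sum_list (map f xs))\<^sup>2) =
        (\<Sum>x\<in>UNIV. \<Sum>xs | length xs = n. (pmf p x * (f x)\<^sup>2) * pmf (replicate_pmf n p) xs +
           (2 * (pmf p x * f x)) * (pmf (replicate_pmf n p) xs * sum_list (map f xs)) +
           pmf p x * (pmf (replicate_pmf n p) xs * (sum_list (map f xs))\<^sup>2))"
      unfolding sum_words_Suc
      by (intro sum.cong refl)
        (simp add: cons power2_eq_square algebra_simps del: replicate_pmf.simps)
    also have "\<dots> = Suc n * (\<Sum>x\<in>UNIV. pmf p x * (f x)\<^sup>2)"
      by (simp add: sum.distrib sum_pmf_words m1 Suc one flip: sum_distrib_left sum_distrib_right)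
        (simp add: algebra_simps)
    finally show ?case .
  qed simp
qed

lemma chebyshev_words:
  fixes f :: "'a::finite \<Rightarrow> real"
  assumes mean: "(\<Sum>x\<in>UNIV. pmf p x * f x) = \<mu>" and "t > 0"
  shows "measure_pmf.prob (replicate_pmf n p) {xs. \<bar>sum_list (map f xs) - n * \<mu>\<bar> \<ge> t} \<le>
           n * (\<Sum>x\<in>UNIV. pmf p x * (f x - \<mu>)\<^sup>2) / t\<^sup>2"
proof -
  define g where "g x = f x - \<mu>" for x
  have one: "(\<Sum>x\<in>UNIV. pmf p x) = 1" by (rule sum_pmf_eq_1) auto
  have "(\<Sum>x\<in>UNIV. pmf p x * g x) = 0"
    using mean by (simp add: g_def right_diff_distrib sum_subtractf one flip: sum_distrib_right)
  note m2 = second_moment_words[OF this, of n]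
  have sg: "sum_list (map g xs) = sum_list (map f xs) - length xs * \<mu>" for xs
    by (induction xs) (auto simp: g_def algebra_simps)
  have "measure_pmf.prob (replicate_pmf n p) {xs. \<bar>sum_list (map f xs) - n * \<mu>\<bar> \<ge> t} \<le>
      (\<Sum>xs | length xs = n \<and> \<bar>sum_list (map f xs) - n * \<mu>\<bar> \<ge> t.
        pmf (replicate_pmf n p) xs * (sum_list (map g xs))\<^sup>2 / t\<^sup>2)"
    unfolding prob_words mem_Collect_eq
  proof (rule sum_mono)
    fix xs assume "xs \<in> {xs. length xs = n \<and> t \<le> \<bar>sum_list (map f xs) - real n * \<mu>\<bar>}"
    then have "t \<le> \<bar>sum_list (map g xs)\<bar>" by (simp add: sg)
    then have "t\<^sup>2 \<le> (sum_list (map g xs))\<^sup>2" using \<open>t > 0\<close> by (simp flip: abs_le_square_iff)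
    then have "1 \<le> (sum_list (map g xs))\<^sup>2 / t\<^sup>2" using \<open>t > 0\<close> by simp
    from mult_left_mono[OF this pmf_nonneg]
    show "pmf (replicate_pmf n p) xs \<le> pmf (replicate_pmf n p) xs * (sum_list (map g xs))\<^sup>2 / t\<^sup>2"
      by (metis mult.right_neutral times_divide_eq_right)
  qed
  also have "\<dots> \<le> (\<Sum>xs | length xs = n. pmf (replicate_pmf n p) xs * (sum_list (map g xs))\<^sup>2 / t\<^sup>2)"
    by (rule sum_mono2) (auto simp: finite_words)
  also have "\<dots> = n * (\<Sum>x\<in>UNIV. pmf p x * (f x - \<mu>)\<^sup>2) / t\<^sup>2"
    unfolding sum_divide_distrib[symmetric] m2 by (simp add: g_def)
  finally show ?thesis .
qed

section \<open>Self-information and its concentration\<close>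

text \<open>Self-information in bits. Off the support the value carries no meaning, so typical sets
  are cut down to the support below.\<close>

definition info :: "'a pmf \<Rightarrow> 'a \<Rightarrow> real" where
  "info p x = - log 2 (pmf p x)"

text \<open>The varentropy of \<open>p\<close>, that is, the variance of its
  self-information.\<close>

definition info_variance :: "'a::finite pmf \<Rightarrow> real" where
  "info_variance p = (\<Sum>x\<in>UNIV. pmf p x * (info p x - shannon_entropy p)\<^sup>2)"

lemma info_variance_nonneg: "info_variance p \<ge> 0"
  unfolding info_variance_def by (intro sum_nonneg mult_nonneg_nonneg) auto

lemma info_replicate_pmf:
  assumes "xs \<in> set_pmf (replicate_pmf n p)"
  shows "info (replicate_pmf n p) xs = sum_list (map (info p) xs)"
proof -
  have "set xs \<subseteq> set_pmf p \<Longrightarrow>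
      prod_list (map (pmf p) xs) > 0 \<and> - log 2 (prod_list (map (pmf p) xs)) = sum_list (map (info p) xs)" for xs
  proof (induction xs)
    case (Cons x xs)
    then have "pmf p x > 0" by (auto intro: pmf_positive)
    then show ?case using Cons by (auto simp: info_def log_mult)
  qed simp
  then show ?thesis
    using assms by (auto simp: info_def pmf_replicate_pmf set_replicate_pmf lists_eq_set)
qed

lemma entropy_nonneg: "shannon_entropy p \<ge> 0"
proof -
  have "pmf p x * log 2 (pmf p x) \<le> 0" for x
  proof (cases "pmf p x = 0")
    case False
    then have "pmf p x > 0" using pmf_nonneg[of p x] by linarith
    then have "log 2 (pmf p x) \<le> 0" by (subst log_le_zero_cancel_iff) (auto simp: pmf_le_1)
    then show ?thesis by (simp add: mult_nonneg_nonpos)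
  qed simp
  then show ?thesis
    unfolding shannon_entropy_eq_sum by (simp add: sum_nonpos)
qed

text \<open>Chebyshev's inequality applies because self-information is additive over the letters and
  has the entropy as its mean. Additivity holds on the support, hence almost surely.\<close>

lemma info_concentration:
  assumes "t > 0"
  shows "measure_pmf.prob (replicate_pmf n p)
           {xs. \<bar>info (replicate_pmf n p) xs - n * shannon_entropy p\<bar> \<ge> t} \<le> n * info_variance p / t\<^sup>2"
proof -
  have "(\<Sum>x\<in>UNIV. pmf p x * info p x) = shannon_entropy p"
    by (simp add: shannon_entropy_eq_sum info_def sum_negf)
  from chebyshev_words[OF this assms, of n]
  have "measure_pmf.prob (replicate_pmf n p) {xs. \<bar>sum_list (map (info p) xs) - n * shannon_entropy p\<bar> \<ge> t}
      \<le> n * info_variance p / t\<^sup>2"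
    by (simp add: info_variance_def)
  moreover have "measure_pmf.prob (replicate_pmf n p)
           {xs. \<bar>info (replicate_pmf n p) xs - n * shannon_entropy p\<bar> \<ge> t} =
        measure_pmf.prob (replicate_pmf n p) {xs. \<bar>sum_list (map (info p) xs) - n * shannon_entropy p\<bar> \<ge> t}"
    by (rule measure_pmf.finite_measure_eq_AE) (auto simp: AE_measure_pmf_iff info_replicate_pmf)
  ultimately show ?thesis by simp
qed

lemma pmf_eq_powr_info: "x \<in> set_pmf p \<Longrightarrow> pmf p x = 2 powr (- info p x)"
  by (simp add: info_def pmf_positive)

section \<open>Divergence\<close>

text \<open>Follows from \<open>ln t \<le> t - 1\<close> with \<open>t = q / p\<close> at each
  point, since \<open>q\<close> gives mass at most 1 to the support of \<open>p\<close>.\<close>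

lemma KL_div_nonneg:
  fixes p q :: "'a::countable pmf"
  assumes "finite (set_pmf p)"
  shows "KL_div p q \<ge> 0"
proof (cases "set_pmf p \<subseteq> set_pmf q")
  case True
  have pointwise: "pmf p x * log 2 (pmf p x / pmf q x) \<ge> (pmf p x - pmf q x) / ln 2" if "x \<in> set_pmf p" for x
  proof -
    have pos: "pmf p x > 0" "pmf q x > 0" using that True by (auto intro: pmf_positive)
    have "ln (pmf q x / pmf p x) \<le> pmf q x / pmf p x - 1" using pos by (intro ln_le_minus_one) simp
    then have "pmf p x * ln (pmf q x / pmf p x) \<le> pmf p x * (pmf q x / pmf p x - 1)"
      using pos by (intro mult_left_mono) auto
    then have "pmf p x - pmf q x \<le> pmf p x * ln (pmf p x / pmf q x)"
      using pos by (simp add: ln_div algebra_simps)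
    then show ?thesis by (simp add: log_def divide_right_mono)
  qed
  have "(\<Sum>x\<in>set_pmf p. pmf p x) = 1" by (rule sum_pmf_eq_1) (use assms in auto)
  moreover have "(\<Sum>x\<in>set_pmf p. pmf q x) \<le> 1"
    using measure_pmf.prob_le_1[of q "set_pmf p"] by (simp add: measure_measure_pmf_finite assms)
  ultimately have "0 \<le> (\<Sum>x\<in>set_pmf p. (pmf p x - pmf q x) / ln 2)"
    by (simp add: sum_subtractf flip: sum_divide_distrib)
  also have "\<dots> \<le> (\<Sum>x\<in>set_pmf p. pmf p x * log 2 (pmf p x / pmf q x))"
    by (intro sum_mono pointwise)
  finally show ?thesis by (simp add: KL_div_eq_sum[OF assms True])
qed (simp add: KL_div_def)

text \<open>Domination forces the inclusion of the supports, so the divergence is finite, and it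
  bounds each log-ratio by \<open>log 2 r\<close>. Covertness of the constructed code is derived
  from such a pointwise bound.\<close>

lemma KL_div_le_log_ratio:
  fixes p q :: "'a::countable pmf"
  assumes "finite (set_pmf p)" and r: "\<And>x. pmf p x \<le> r * pmf q x"
  shows "KL_div p q \<le> log 2 r"
proof -
  have sub: "set_pmf p \<subseteq> set_pmf q" 
    using r pmf_positive by (metis mult_zero_right not_less pmf_eq_0_set_pmf subsetI)
  have pointwise: "pmf p x * log 2 (pmf p x / pmf q x) \<le> pmf p x * log 2 r" if "x \<in> set_pmf p" for x
  proof -
    have pos: "pmf p x > 0" "pmf q x > 0" using that sub by (auto intro: pmf_positive)
    then have "pmf p x / pmf q x \<le> r" using r[of x] by (simp add: field_simps)
    then have "log 2 (pmf p x / pmf q x) \<le> log 2 r"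
      by (smt (verit) divide_pos_pos log_le_cancel_iff pos)
    then show ?thesis using pos by simp
  qed
  have "(\<Sum>x\<in>set_pmf p. pmf p x * log 2 (pmf p x / pmf q x)) \<le> (\<Sum>x\<in>set_pmf p. pmf p x * log 2 r)"
    by (intro sum_mono pointwise)
  also have "\<dots> = log 2 r"
    using sum_pmf_eq_1[of "set_pmf p" p] assms(1) by (simp flip: sum_distrib_right)
  finally show ?thesis by (simp add: KL_div_eq_sum[OF assms(1) sub])
qed

text \<open>
  Gibbs' inequality against the measure that inflates \<open>q\<close> by the factor \<open>1 / r\<close> on \<open>B\<close>.
\<close>
lemma prob_le_of_KL_div:
  fixes p q :: "'a::countable pmf"
  assumes fin: "finite (set_pmf p)" and KL: "KL_div p q < 1"
    and r: "0 < r" "r < 1" and B: "measure_pmf.prob q B \<le> r"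
  shows "measure_pmf.prob p B \<le> 2 / ln (1 / r)"
proof -
  let ?S = "set_pmf p"
  have sub: "?S \<subseteq> set_pmf q" using KL by (auto simp: KL_div_def split: if_splits)
  define w where "w x = (if x \<in> B then 1 / r else 1)" for x
  have wpos: "w x > 0" for x using r by (auto simp: w_def)
  have pointwise: "pmf p x * ln (pmf p x / pmf q x) \<ge> pmf p x + pmf p x * ln (w x) - pmf q x * w x"
    if "x \<in> ?S" for x
  proof -
    have pos: "pmf p x > 0" "pmf q x > 0" using that sub by (auto intro: pmf_positive)
    have "ln (pmf q x * w x / pmf p x) \<le> pmf q x * w x / pmf p x - 1"
      using pos wpos by (intro ln_le_minus_one) simp
    then have "pmf p x * ln (pmf q x * w x / pmf p x) \<le> pmf p x * (pmf q x * w x / pmf p x - 1)"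
      using pos by (intro mult_left_mono) auto
    then show ?thesis
      using pos wpos[of x] by (simp add: ln_div ln_mult algebra_simps)
  qed
  have one: "(\<Sum>x\<in>?S. pmf p x) = 1" by (rule sum_pmf_eq_1) (use fin in auto)
  have pB: "measure_pmf.prob p B = (\<Sum>x\<in>?S \<inter> B. pmf p x)"
  proof -
    have "measure_pmf.prob p B = measure_pmf.prob p (?S \<inter> B)"
      by (rule measure_pmf.finite_measure_eq_AE) (auto simp: AE_measure_pmf_iff)
    then show ?thesis using fin by (simp add: measure_measure_pmf_finite)
  qed
  have lw: "(\<Sum>x\<in>?S. pmf p x * ln (w x)) = measure_pmf.prob p B * ln (1 / r)"
  proof -
    have "(\<Sum>x\<in>?S. pmf p x * ln (w x)) = (\<Sum>x\<in>?S \<inter> B. pmf p x * ln (1 / r))"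
      using fin by (subst sum.inter_restrict) (auto simp: w_def intro!: sum.cong)
    then show ?thesis by (simp add: pB sum_distrib_right)
  qed
  \<comment> \<open>The inflated measure has total mass at most 2: \<open>q\<close> itself
    contributes at most 1, and the inflated part on \<open>B\<close> at most
    \<open>r * (1 / r)\<close>.\<close>
  have qw: "(\<Sum>x\<in>?S. pmf q x * w x) \<le> 2"
  proof -
    have "(\<Sum>x\<in>?S. pmf q x * w x) \<le> (\<Sum>x\<in>?S. pmf q x + (if x \<in> B then pmf q x * (1 / r) else 0))"
      by (intro sum_mono) (auto simp: w_def)
    also have "\<dots> = (\<Sum>x\<in>?S. pmf q x) + (\<Sum>x\<in>?S \<inter> B. pmf q x) * (1 / r)"
      using fin by (auto simp: sum.distrib sum.inter_restrict sum_divide_distrib intro!: sum.cong)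
    also have "(\<Sum>x\<in>?S. pmf q x) \<le> 1"
      using measure_pmf.prob_le_1[of q ?S] by (simp add: measure_measure_pmf_finite fin)
    also have "(\<Sum>x\<in>?S \<inter> B. pmf q x) * (1 / r) \<le> r * (1 / r)"
    proof (rule mult_right_mono)
      have "(\<Sum>x\<in>?S \<inter> B. pmf q x) = measure_pmf.prob q (?S \<inter> B)"
        using fin by (simp add: measure_measure_pmf_finite)
      also have "\<dots> \<le> measure_pmf.prob q B" by (rule measure_pmf.finite_measure_mono) auto
      finally show "(\<Sum>x\<in>?S \<inter> B. pmf q x) \<le> r" using B by simp
    qed (use r in simp)
    finally show ?thesis using r by simp
  qed
  have "(\<Sum>x\<in>?S. pmf p x * log 2 (pmf p x / pmf q x)) < 1"
    using KL by (simp add: KL_div_eq_sum[OF fin sub] one_ereal_def)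
  moreover have "(\<Sum>x\<in>?S. pmf p x * ln (pmf p x / pmf q x)) =
      ln 2 * (\<Sum>x\<in>?S. pmf p x * log 2 (pmf p x / pmf q x))"
    by (simp add: sum_distrib_left log_def)
  ultimately have "(\<Sum>x\<in>?S. pmf p x * ln (pmf p x / pmf q x)) < ln 2 * 1"
    by simp
  then have "(\<Sum>x\<in>?S. pmf p x * ln (pmf p x / pmf q x)) \<le> 1"
    using ln_2_less_1 by linarith
  moreover have "1 + measure_pmf.prob p B * ln (1 / r) - 2 \<le> (\<Sum>x\<in>?S. pmf p x * ln (pmf p x / pmf q x))"
  proof -
    have "1 + measure_pmf.prob p B * ln (1 / r) - 2 \<le>
        (\<Sum>x\<in>?S. pmf p x + pmf p x * ln (w x) - pmf q x * w x)"
      using one lw qw by (simp add: sum.distrib sum_subtractf)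
    also have "\<dots> \<le> (\<Sum>x\<in>?S. pmf p x * ln (pmf p x / pmf q x))"
      by (intro sum_mono pointwise)
    finally show ?thesis .
  qed
  ultimately have "measure_pmf.prob p B * ln (1 / r) \<le> 2" by linarith
  moreover have "ln (1 / r) > 0" using r by (simp add: ln_div)
  ultimately show ?thesis by (simp add: pos_le_divide_eq)
qed

section \<open>Converse\<close>

text \<open>Each element of \<open>A\<close> takes at least \<open>c\<close> of the total mass 1.
  Finiteness is part of the claim, so the count is first made for finite subsets.\<close>

lemma card_high_probability:
  fixes p :: "'a pmf"
  assumes "\<And>x. x \<in> A \<Longrightarrow> pmf p x \<ge> c" "c > 0"
  shows "finite A" "real (card A) \<le> 1 / c"
proof -
  have bound: "real (card F) \<le> 1 / c" if "F \<subseteq> A" "finite F" for F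
  proof -
    have "real (card F) * c = (\<Sum>x\<in>F. c)" by simp
    also have "\<dots> \<le> (\<Sum>x\<in>F. pmf p x)" by (intro sum_mono) (use that assms in auto)
    also have "\<dots> \<le> 1"
      using measure_pmf.prob_le_1[of p F] that by (simp add: measure_measure_pmf_finite)
    finally show ?thesis using \<open>c > 0\<close> by (simp add: pos_le_divide_eq)
  qed
  show "finite A"
  proof (rule ccontr)
    assume "infinite A"
    then obtain F where "F \<subseteq> A" "finite F" "card F = Suc (nat \<lfloor>1 / c\<rfloor>)"
      using infinite_arbitrarily_large by blast
    with bound[of F] show False by linarith
  qed
  with bound[of A] show "real (card A) \<le> 1 / c" by simp
qed

section \<open>The joint law of source word and seed, and the conditional output law\<close>

lemma finite_seeds: "finite (seeds C)"
  by (simp add: seeds_def)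

lemma card_seeds: "card (seeds C) = 2 ^ seed_length C"
  by (simp add: seeds_def)

lemma seeds_nonempty: "seeds C \<noteq> {}"
  using card_seeds[of C] by force

lemma set_source_seed_pmf:
  "set_pmf (source_seed_pmf n p C) = set_pmf (replicate_pmf n p) \<times> seeds C"
  by (simp add: source_seed_pmf_def finite_seeds seeds_nonempty)

lemma finite_set_source_seed_pmf: "finite (set_pmf (source_seed_pmf n (p :: 'x::finite pmf) C))"
  unfolding set_source_seed_pmf
  by (auto simp: finite_seeds set_replicate_pmf intro!: finite_cartesian_product finite_subset[OF _ finite_words[of n]])

lemma prob_source_seed_fst:
  "measure_pmf.prob (source_seed_pmf n p C) {(x, u). P x} = measure_pmf.prob (replicate_pmf n p) {x. P x}"
proof -
  have "measure_pmf.prob (replicate_pmf n p) {x. P x} =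
      measure_pmf.prob (map_pmf fst (source_seed_pmf n p C)) {x. P x}"
    by (simp only: source_seed_pmf_def map_fst_pair_pmf)
  also have "\<dots> = measure_pmf.prob (source_seed_pmf n p C) {(x, u). P x}"
    by (simp add: vimage_def case_prod_unfold)
  finally show ?thesis by simp
qed

text \<open>Undoes the conditioning in \<open>output_pmf\<close>. A source word \<open>x\<close> of
  positive probability guarantees that its length \<open>k\<close> has positive probability, so that
  the conditional law is defined.\<close>

lemma prob_output_pmf:
  fixes p :: "'x::finite pmf" and C :: "('x, 'y) covert_code"
  assumes "x \<in> set_pmf (replicate_pmf n p)"
  defines "k \<equiv> out_length C x"
  shows "measure_pmf.prob (source_seed_pmf n p C) {(x, u). out_length C x = k \<and> encode C x u \<in> B} =
     measure_pmf.prob (replicate_pmf n p) {x. out_length C x = k} * measure_pmf.prob (output_pmf n p C k) B"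
proof -
  let ?D = "source_seed_pmf n p C" and ?S = "{(x, u). out_length C x = k}"
  have ne: "set_pmf ?D \<inter> ?S \<noteq> {}"
    using assms seeds_nonempty[of C] by (auto simp: set_source_seed_pmf)
  then have pos: "measure_pmf.prob ?D ?S > 0"
    using measure_pmf_posI by fastforce
  have fin: "finite (set_pmf ?D)" by (rule finite_set_source_seed_pmf)
  have prob_fin: "measure_pmf.prob M A = (\<Sum>x\<in>set_pmf M \<inter> A. pmf M x)" if "finite (set_pmf M)" for M :: "'z pmf" and A
  proof -
    have "measure_pmf.prob M A = measure_pmf.prob M (set_pmf M \<inter> A)"
      by (rule measure_pmf.finite_measure_eq_AE) (auto simp: AE_measure_pmf_iff)
    then show ?thesis using that by (simp add: measure_measure_pmf_finite)
  qed
  let ?E = "(\<lambda>(x, u). encode C x u) -` B"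
  have "measure_pmf.prob (output_pmf n p C k) B = measure_pmf.prob (cond_pmf ?D ?S) ?E"
    by (simp add: output_pmf_def)
  also have "\<dots> = (\<Sum>x\<in>set_pmf ?D \<inter> ?S \<inter> ?E. pmf ?D x / measure_pmf.prob ?D ?S)"
    using ne fin by (subst prob_fin) (auto simp: pmf_cond intro!: sum.cong)
  also have "\<dots> = measure_pmf.prob ?D (?S \<inter> ?E) / measure_pmf.prob ?D ?S"
    using fin by (simp add: prob_fin Int_assoc sum_divide_distrib)
  finally have "measure_pmf.prob (output_pmf n p C k) B * measure_pmf.prob ?D ?S = measure_pmf.prob ?D (?S \<inter> ?E)"
    using pos by simp
  moreover have "?S \<inter> ?E = {(x, u). out_length C x = k \<and> encode C x u \<in> B}" by auto
  ultimately show ?thesis by (simp add: prob_source_seed_fst mult.commute)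
qed

lemma finite_set_output_pmf:
  fixes p :: "'x::finite pmf"
  assumes "x \<in> set_pmf (replicate_pmf n p)"
  shows "finite (set_pmf (output_pmf n p C (out_length C x)))"
proof -
  have ne: "set_pmf (source_seed_pmf n p C) \<inter> {(x', u). out_length C x' = out_length C x} \<noteq> {}"
    using assms seeds_nonempty[of C] by (auto simp: set_source_seed_pmf)
  show ?thesis
    using finite_set_source_seed_pmf[of n p C] by (simp add: output_pmf_def set_cond_pmf[OF ne])
qed

text \<open>For each length realized in \<open>A\<close>, small divergence carries the smallness of
  \<open>B k\<close> from the product law over to the conditional output law; averaging over the
  lengths keeps the bound. Covertness depends on the source word only through its length, so it is
  harmless that the event is enlarged to all words with such a length.\<close>

lemma prob_atypical_output:
  fixes p :: "'x::finite pmf" and q :: "'y::finite pmf"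
  assumes r: "0 < r" "r < 1"
    and B: "\<And>x. x \<in> A \<Longrightarrow>
      measure_pmf.prob (replicate_pmf (out_length C x) q) (B (out_length C x)) \<le> r"
    and cov: "\<And>x. x \<in> A \<Longrightarrow> covertness n p q C x < 1"
  shows "measure_pmf.prob (source_seed_pmf n p C) {(x, u). x \<in> A \<and> encode C x u \<in> B (out_length C x)}
     \<le> 2 / ln (1 / r)"
proof -
  let ?D = "source_seed_pmf n p C" and ?P = "replicate_pmf n p"
  define K where "K = out_length C ` (A \<inter> set_pmf ?P)"
  have "finite (set_pmf ?P)" by (auto simp: set_replicate_pmf intro: finite_subset[OF _ finite_words])
  then have finK: "finite K" by (simp add: K_def)
  have eta: "2 / ln (1 / r) \<ge> 0" using r by simp
  let ?E = "\<lambda>k. {(x, u). out_length C x = k \<and> encode C x u \<in> B k}"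
  have "measure_pmf.prob ?D {(x, u). x \<in> A \<and> encode C x u \<in> B (out_length C x)} \<le>
      measure_pmf.prob ?D (\<Union>k\<in>K. ?E k)"
    by (rule measure_pmf.finite_measure_mono_AE)
      (auto simp: AE_measure_pmf_iff set_source_seed_pmf K_def)
  also have "\<dots> \<le> (\<Sum>k\<in>K. measure_pmf.prob ?D (?E k))"
    by (rule measure_pmf.finite_measure_subadditive_finite) (use finK in auto)
  also have "\<dots> \<le> (\<Sum>k\<in>K. measure_pmf.prob ?P {x. out_length C x = k} * (2 / ln (1 / r)))"
  proof (rule sum_mono)
    fix k assume "k \<in> K"
    then obtain x where x: "x \<in> A" "x \<in> set_pmf ?P" "k = out_length C x" by (auto simp: K_def)
    have "measure_pmf.prob (output_pmf n p C k) (B k) \<le> 2 / ln (1 / r)"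
      using finite_set_output_pmf[OF x(2), of C] cov[OF x(1)] r B[OF x(1)]
      unfolding covertness_def x(3) by (rule prob_le_of_KL_div)
    then show "measure_pmf.prob ?D (?E k) \<le> measure_pmf.prob ?P {x. out_length C x = k} * (2 / ln (1 / r))"
      unfolding x(3) prob_output_pmf[OF x(2)] by (rule mult_left_mono) simp
  qed
  also have "\<dots> = measure_pmf.prob ?P (\<Union>k\<in>K. {x. out_length C x = k}) * (2 / ln (1 / r))"
    unfolding sum_distrib_right[symmetric]
    by (subst measure_pmf.finite_measure_finite_Union[symmetric]) (use finK in \<open>auto simp: disjoint_family_on_def\<close>)
  also have "\<dots> \<le> 1 * (2 / ln (1 / r))"
    by (rule mult_right_mono) (use eta in auto)
  finally show ?thesis by simp
qed

text \<open>A union bound for each fixed seed, averaged over the uniform seed.\<close>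

lemma prob_source_seed_le:
  fixes p :: "'x::finite pmf"
  assumes "\<And>u. u \<in> seeds C \<Longrightarrow> finite {x. P x u}"
    and "\<And>u. u \<in> seeds C \<Longrightarrow> real (card {x. P x u}) \<le> N"
    and "\<And>x u. u \<in> seeds C \<Longrightarrow> P x u \<Longrightarrow> pmf (replicate_pmf n p) x \<le> c"
    and "c \<ge> 0"
  shows "measure_pmf.prob (source_seed_pmf n p C) {(x, u). P x u} \<le> N * c"
proof -
  let ?D = "source_seed_pmf n p C" and ?E = "SIGMA u : seeds C. {x. P x u}"
  have fin: "finite ?E" using assms(1) finite_seeds by blast
  have "measure_pmf.prob ?D {(x, u). P x u} \<le> measure_pmf.prob ?D ((\<lambda>(u, x). (x, u)) ` ?E)"
    by (rule measure_pmf.finite_measure_mono_AE)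
      (auto simp: AE_measure_pmf_iff set_source_seed_pmf image_iff)
  also have "\<dots> = (\<Sum>(u, x)\<in>?E. pmf ?D (x, u))"
    using fin by (subst measure_measure_pmf_finite) (auto simp: sum.reindex inj_on_def case_prod_unfold)
  also have "\<dots> = (\<Sum>u\<in>seeds C. \<Sum>x | P x u. pmf ?D (x, u))"
    using assms(1) finite_seeds by (subst sum.Sigma) auto
  also have "\<dots> \<le> (\<Sum>u\<in>seeds C. \<Sum>x | P x u. c / 2 ^ seed_length C)"
    using assms(3)
    by (intro sum_mono)
      (auto simp: source_seed_pmf_def pmf_pair finite_seeds seeds_nonempty card_seeds divide_right_mono)
  also have "\<dots> = (\<Sum>u\<in>seeds C. card {x. P x u} * c / 2 ^ seed_length C)" by simp
  also have "\<dots> \<le> (\<Sum>u\<in>seeds C. N * c / 2 ^ seed_length C)"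
    by (intro sum_mono divide_right_mono mult_right_mono assms) auto
  also have "\<dots> = N * c" by (simp add: card_seeds)
  finally show ?thesis .
qed

text \<open>For a fixed seed, decodability makes the encoder injective on the event. Its outputs are
  words of some length \<open>k \<le> \<alpha>\<close> and probability at least
  \<open>2 powr - (k * h + g)\<close>, of which there are at most \<open>2 powr (k * h + g)\<close>;
  the factor \<open>\<alpha> + 1\<close> counts the lengths. The maximum covers negative
  \<open>c\<close>.\<close>

lemma prob_decodable:
  fixes p :: "'x::finite pmf" and q :: "'y pmf" and g h :: real
  assumes code: "is_code n C" and "\<alpha> \<ge> 0" and h: "h \<ge> 0" "g \<ge> 0"
  shows "measure_pmf.prob (source_seed_pmf n p C)
      {(x, u). length x = n \<and> decode C (encode C x u) u = x \<and> real (out_length C x) \<le> \<alpha> \<and>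
         pmf (replicate_pmf (out_length C x) q) (encode C x u) \<ge> 2 powr - (out_length C x * h + g) \<and>
         pmf (replicate_pmf n p) x \<le> c} \<le> (\<alpha> + 1) * 2 powr (\<alpha> * h + g) * max c 0"
proof (rule prob_source_seed_le)
  fix u assume u: "u \<in> seeds C"
  let ?X = "{x. length x = n \<and> decode C (encode C x u) u = x \<and> real (out_length C x) \<le> \<alpha> \<and>
         pmf (replicate_pmf (out_length C x) q) (encode C x u) \<ge> 2 powr - (out_length C x * h + g) \<and>
         pmf (replicate_pmf n p) x \<le> c}"
  show fin: "finite ?X" by (rule finite_subset[OF _ finite_words[of n]]) auto
  let ?G = "\<lambda>k. {y. pmf (replicate_pmf k q) y \<ge> 2 powr - (real k * h + g)}"
  have G: "finite (?G k)" "real (card (?G k)) \<le> 2 powr (real k * h + g)" for k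
    using card_high_probability[of "?G k" "2 powr - (real k * h + g)" "replicate_pmf k q"]
    by (auto simp: powr_diff powr_add powr_minus field_simps)
  have inj: "inj_on (\<lambda>x. encode C x u) ?X" by (rule inj_on_inverseI[where g = "\<lambda>y. decode C y u"]) auto
  have "(\<lambda>x. encode C x u) ` ?X \<subseteq> (\<Union>k\<in>{..nat \<lfloor>\<alpha>\<rfloor>}. ?G k)"
    by (auto simp: le_nat_floor intro!: bexI[of _ "out_length C _"])
  then have "card ?X \<le> card (\<Union>k\<in>{..nat \<lfloor>\<alpha>\<rfloor>}. ?G k)"
    by (intro card_inj_on_le[OF inj] finite_UN_I G(1) finite_atMost)
  also have "\<dots> \<le> (\<Sum>k\<le>nat \<lfloor>\<alpha>\<rfloor>. card (?G k))" by (rule card_UN_le) simp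
  finally have "real (card ?X) \<le> real (\<Sum>k\<le>nat \<lfloor>\<alpha>\<rfloor>. card (?G k))"
    by (rule of_nat_mono)
  also have "\<dots> = (\<Sum>k\<le>nat \<lfloor>\<alpha>\<rfloor>. real (card (?G k)))" by (rule of_nat_sum)
  also have "\<dots> \<le> (\<Sum>k\<le>nat \<lfloor>\<alpha>\<rfloor>. 2 powr (\<alpha> * h + g))"
  proof (rule sum_mono)
    fix k assume "k \<in> {..nat \<lfloor>\<alpha>\<rfloor>}"
    then have "real k \<le> \<alpha>" using \<open>\<alpha> \<ge> 0\<close> by (simp add: le_nat_iff le_floor_iff)
    then have "2 powr (real k * h + g) \<le> 2 powr (\<alpha> * h + g)"
      using h by (intro powr_mono add_right_mono mult_right_mono) auto
    with G(2)[of k] show "real (card (?G k)) \<le> 2 powr (\<alpha> * h + g)" by linarith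
  qed
  also have "\<dots> = real (nat \<lfloor>\<alpha>\<rfloor> + 1) * 2 powr (\<alpha> * h + g)" by simp
  also have "\<dots> \<le> (\<alpha> + 1) * 2 powr (\<alpha> * h + g)"
    using \<open>\<alpha> \<ge> 0\<close> by (intro mult_right_mono) auto
  finally show "real (card ?X) \<le> (\<alpha> + 1) * 2 powr (\<alpha> * h + g)" .
qed auto

text \<open>A source word with a short output is decoded wrongly, has large divergence, is atypical,
  has an atypical output, or is one of the few decodable typical words with typical output. Each of
  the five events has vanishing probability.\<close>

lemma short_outputs_vanish:
  fixes pX :: "'x::finite pmf" and pY :: "'y::finite pmf"
  assumes uc: "universal_covert pY C" and "a \<ge> 0" and rate: "a * shannon_entropy pY < shannon_entropy pX"
  shows "(\<lambda>n. measure_pmf.prob (replicate_pmf n pX) {x. real (out_length (C n) x) \<le> a * n}) \<longlonglongrightarrow> 0"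
proof -
  let ?H = "shannon_entropy pX" and ?h = "shannon_entropy pY" and ?P = "\<lambda>n. replicate_pmf n pX"
  \<comment> \<open>One third of the entropy gap is spent on the typicality of the source, one on
    that of the output, and the last remains as the exponent of decay in \<open>?e5\<close>.\<close>
  define \<delta> where "\<delta> = (?H - a * ?h) / 3"
  have \<delta>: "\<delta> > 0" using rate by (simp add: \<delta>_def)
  \<comment> \<open>Chebyshev bounds the product probability of an atypical word of length at most
    \<open>a * n\<close> by \<open>(c - 1) / n\<close>. The added 1 keeps the bound
    \<open>c / n\<close> positive even if the variance or \<open>a\<close> is zero.\<close>
  define c where "c = a * info_variance pY / \<delta>\<^sup>2 + 1"
  have c: "c \<ge> 1" using \<open>a \<ge> 0\<close> info_variance_nonneg[of pY] by (simp add: c_def)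
  let ?e1 = "\<lambda>n. error_prob n pX (C n)"
  let ?e2 = "\<lambda>n. measure_pmf.prob (?P n) {x. covertness n pX pY (C n) x \<notin> {..<1}}"
  let ?e3 = "\<lambda>n. n * info_variance pX / (\<delta> * real n)\<^sup>2"
  let ?e4 = "\<lambda>n. 2 / ln (1 / (c / real n))"
  let ?e5 = "\<lambda>n. (a * real n + 1) * 2 powr (a * real n * ?h + \<delta> * n) * 2 powr (- (n * ?H - \<delta> * n))"
  have lim1: "?e1 \<longlonglongrightarrow> 0" using uc by (simp add: universal_covert_def)
  have lim2: "?e2 \<longlonglongrightarrow> 0"
    using uc unfolding universal_covert_def p_lim_def by (auto dest!: spec[of _ pX] conjunct2 spec[of _ "{..<1}"])
  have lim3: "?e3 \<longlonglongrightarrow> 0"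
    using \<delta> info_variance_nonneg[of pX] by real_asymp
  have lim4: "?e4 \<longlonglongrightarrow> 0" using c by real_asymp
  have lim5: "?e5 \<longlonglongrightarrow> 0"
  proof -
    have "?e5 = (\<lambda>n. (a * real n + 1) * 2 powr (- (\<delta> * n)))"
    proof
      fix n
      have eq: "a * real n * ?h + \<delta> * n + - (n * ?H - \<delta> * n) = - (\<delta> * n)"
        by (simp add: \<delta>_def field_simps)
      then show "?e5 n = (a * real n + 1) * 2 powr (- (\<delta> * n))"
        unfolding mult.assoc[of "a * real n + 1"] powr_add[symmetric] eq by simp
    qed
    moreover have "(\<lambda>n. (a * real n + 1) * 2 powr (- (\<delta> * n))) \<longlonglongrightarrow> 0"
      using \<delta> by real_asymp
    ultimately show ?thesis by simp
  qed
  have lim: "(\<lambda>n. ?e1 n + ?e2 n + ?e3 n + ?e4 n + ?e5 n) \<longlonglongrightarrow> 0"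
    using tendsto_add[OF tendsto_add[OF tendsto_add[OF tendsto_add[OF lim1 lim2] lim3] lim4] lim5] by simp
  have bound: "measure_pmf.prob (?P n) {x. real (out_length (C n) x) \<le> a * n} \<le>
      ?e1 n + ?e2 n + ?e3 n + ?e4 n + ?e5 n" if "real n > c" for n
  proof -
    have n: "real n > 0" using that c by linarith
    let ?D = "source_seed_pmf n pX (C n)" and ?m = "out_length (C n)"
    have code: "is_code n (C n)" using uc by (simp add: universal_covert_def)
    \<comment> \<open>The allowed deviation is proportional to \<open>n\<close> and not to the
      output length \<open>k\<close>, so that one bound serves all lengths up to
      \<open>a * n\<close>, however short.\<close>
    define B where "B k = {y. \<bar>info (replicate_pmf k pY) y - k * ?h\<bar> \<ge> \<delta> * n} \<union> - set_pmf (replicate_pmf k pY)" for k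
    define A where "A = {x. real (?m x) \<le> a * n \<and> covertness n pX pY (C n) x < 1}"
    let ?E1 = "{(x, u). x \<noteq> decode (C n) (encode (C n) x u) u}"
    let ?E2 = "{(x, u::nat). covertness n pX pY (C n) x \<notin> {..<1}}"
    let ?E3 = "{(x, u::nat). \<bar>info (?P n) x - n * ?H\<bar> \<ge> \<delta> * n}"
    let ?E4 = "{(x, u). x \<in> A \<and> encode (C n) x u \<in> B (?m x)}"
    let ?E5 = "{(x, u). length x = n \<and> decode (C n) (encode (C n) x u) u = x \<and> real (?m x) \<le> a * n \<and>
         pmf (replicate_pmf (?m x) pY) (encode (C n) x u) \<ge> 2 powr - (?m x * ?h + \<delta> * n) \<and>
         pmf (?P n) x \<le> 2 powr (- (n * ?H - \<delta> * n))}"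
    have cover: "(x, u) \<in> ?E1 \<union> ?E2 \<union> ?E3 \<union> ?E4 \<union> ?E5"
      if xu: "(x, u) \<in> set_pmf ?D" and m: "real (?m x) \<le> a * n" for x u
    proof (rule ccontr)
      assume *: "(x, u) \<notin> ?E1 \<union> ?E2 \<union> ?E3 \<union> ?E4 \<union> ?E5"
      then have E1: "decode (C n) (encode (C n) x u) u = x" and E2: "covertness n pX pY (C n) x < 1"
        and E3: "\<not> \<bar>info (?P n) x - n * ?H\<bar> \<ge> \<delta> * n" and E4: "(x, u) \<notin> ?E4" and E5: "(x, u) \<notin> ?E5"
        by simp_all
      have x: "x \<in> set_pmf (?P n)" "length x = n" using xu by (auto simp: set_source_seed_pmf set_replicate_pmf)
      have "pmf (?P n) x \<le> 2 powr (- (n * ?H - \<delta> * n))"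
        using E3 by (subst pmf_eq_powr_info[OF x(1)]) (auto intro!: powr_mono)
      moreover have "encode (C n) x u \<notin> B (?m x)" using E4 E2 m by (auto simp: A_def)
      then have "pmf (replicate_pmf (?m x) pY) (encode (C n) x u) \<ge> 2 powr - (?m x * ?h + \<delta> * n)"
        by (subst pmf_eq_powr_info) (auto simp: B_def intro!: powr_mono)
      ultimately show False using E5 E1 m x by simp
    qed
    have "measure_pmf.prob (?P n) {x. real (?m x) \<le> a * n} = measure_pmf.prob ?D {(x, u). real (?m x) \<le> a * n}"
      by (rule prob_source_seed_fst[symmetric])
    also have "\<dots> \<le> measure_pmf.prob ?D (?E1 \<union> ?E2 \<union> ?E3 \<union> ?E4 \<union> ?E5)"
      by (rule measure_pmf.finite_measure_mono_AE, unfold AE_measure_pmf_iff) (use cover in blast, simp)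
    also have "\<dots> \<le> measure_pmf.prob ?D ?E1 + measure_pmf.prob ?D ?E2 + measure_pmf.prob ?D ?E3 +
        measure_pmf.prob ?D ?E4 + measure_pmf.prob ?D ?E5"
      by (intro order_trans[OF measure_Un_le] add_mono order_refl) auto
    also have "measure_pmf.prob ?D ?E1 = ?e1 n" by (simp add: error_prob_def)
    also have "measure_pmf.prob ?D ?E2 = ?e2 n" by (rule prob_source_seed_fst)
    also have "measure_pmf.prob ?D ?E3 \<le> ?e3 n"
      unfolding prob_source_seed_fst by (rule info_concentration) (use \<delta> n in simp)
    also have "measure_pmf.prob ?D ?E4 \<le> ?e4 n"
    proof (rule prob_atypical_output)
      show "0 < c / real n" "c / real n < 1" using c n that by auto
      show "covertness n pX pY (C n) x < 1" if "x \<in> A" for x using that by (simp add: A_def)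
      fix x assume "x \<in> A"
      then have k: "real (?m x) \<le> a * n" by (simp add: A_def)
      let ?Q = "replicate_pmf (?m x) pY"
      have "measure_pmf.prob ?Q (B (?m x)) =
          measure_pmf.prob ?Q {y. \<bar>info ?Q y - ?m x * ?h\<bar> \<ge> \<delta> * n}"
        by (rule measure_pmf.finite_measure_eq_AE) (auto simp: AE_measure_pmf_iff B_def)
      also have "\<dots> \<le> ?m x * info_variance pY / (\<delta> * n)\<^sup>2"
        by (rule info_concentration) (use \<delta> n in simp)
      also have "\<dots> \<le> (a * n) * info_variance pY / (\<delta> * n)\<^sup>2"
        by (intro divide_right_mono mult_right_mono k info_variance_nonneg) simp
      also have "\<dots> = (c - 1) / n"
        using n \<delta> by (simp add: c_def power2_eq_square field_simps)
      also have "\<dots> \<le> c / n" using n by (intro divide_right_mono) auto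
      finally show "measure_pmf.prob ?Q (B (?m x)) \<le> c / real n" .
    qed
    also have "measure_pmf.prob ?D ?E5 \<le> ?e5 n"
      using prob_decodable[OF code, of "a * n" ?h "\<delta> * n" pX pY "2 powr (- (n * ?H - \<delta> * n))"]
        \<open>a \<ge> 0\<close> entropy_nonneg[of pY] \<delta> by simp
    finally show ?thesis by simp
  qed
  have ev: "\<forall>\<^sub>F n in sequentially. real n > c" by real_asymp
  show ?thesis
    by (rule tendsto_sandwich[OF always_eventually eventually_mono[OF ev bound] tendsto_const lim])
      (intro allI measure_nonneg)
qed

text \<open>Were \<open>R\<close> smaller, some \<open>a\<close> below the entropy ratio would bound
  the rate with probability tending to 1. The outputs of rate at most \<open>a\<close> have
  vanishing probability, yet the two events cover everything.\<close>

lemma achievable_rate_ge: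
  fixes pX :: "'x::finite pmf" and pY :: "'y::finite pmf"
  assumes H: "shannon_entropy pY > 0" and "achievable pX pY R"
  shows "R \<ge> shannon_entropy pX / shannon_entropy pY"
proof (rule ccontr)
  assume "\<not> ?thesis"
  then have R: "R < shannon_entropy pX / shannon_entropy pY" by simp
  obtain C :: "nat \<Rightarrow> ('x, 'y) covert_code" where C: "universal_covert pY C"
    and lim: "p_limsup (\<lambda>n. replicate_pmf n pX) (length_rate C) \<le> ereal R"
    using assms(2) by (auto simp: achievable_def)
  from lim R have "p_limsup (\<lambda>n. replicate_pmf n pX) (length_rate C) < ereal (shannon_entropy pX / shannon_entropy pY)"
    by (metis ereal_less_eq(3) le_less_trans less_ereal.simps(1))
  then obtain a where a: "a < shannon_entropy pX / shannon_entropy pY"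
    "(\<lambda>n. measure_pmf.prob (replicate_pmf n pX) {x. length_rate C n x > a}) \<longlonglongrightarrow> 0"
    by (auto simp: p_limsup_def Inf_less_iff)
  define b where "b n = measure_pmf.prob (replicate_pmf n pX) {x. real (out_length (C n) x) \<le> a * n}" for n
  have "b \<longlonglongrightarrow> 0"
  proof (cases "a \<ge> 0")
    case True
    then show ?thesis using short_outputs_vanish[OF C True] a(1) H by (simp add: b_def[abs_def] pos_less_divide_eq)
  next
    \<comment> \<open>A negative \<open>a\<close> is possible because \<open>p_limsup\<close> ranges
      over all reals; lengths being nonnegative, the event is then empty for
      \<open>n > 0\<close>.\<close>
    case False
    have "eventually (\<lambda>n. b n = 0) sequentially"
      using eventually_gt_at_top[of 0]
    proof eventually_elim
      case (elim n)
      then have "a * n < 0" using False by (simp add: mult_neg_pos)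
      then have "\<not> real (out_length (C n) x) \<le> a * n" for x by (smt (verit) of_nat_0_le_iff)
      then show ?case by (simp add: b_def)
    qed
    then show ?thesis by (rule tendsto_eventually)
  qed
  with a(2) have "(\<lambda>n. measure_pmf.prob (replicate_pmf n pX) {x. length_rate C n x > a} + b n) \<longlonglongrightarrow> 0"
    using tendsto_add by fastforce
  moreover have "\<forall>\<^sub>F n in sequentially. 1 \<le> measure_pmf.prob (replicate_pmf n pX) {x. length_rate C n x > a} + b n"
    using eventually_gt_at_top[of 0]
  proof eventually_elim
    case (elim n)
    have "1 = measure_pmf.prob (replicate_pmf n pX) ({x. length_rate C n x > a} \<union> {x. real (out_length (C n) x) \<le> a * n})"
      by (rule sym, subst measure_pmf.prob_eq_1)
        (use elim in \<open>auto simp: AE_measure_pmf_iff length_rate_def pos_less_divide_eq\<close>)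
    also have "\<dots> \<le> measure_pmf.prob (replicate_pmf n pX) {x. length_rate C n x > a} + b n"
      unfolding b_def by (rule measure_Un_le) auto
    finally show ?case .
  qed
  ultimately have "(1::real) \<le> 0"
    by (intro tendsto_lowerbound[of _ 0 sequentially 1]) auto
  then show False by simp
qed

section \<open>Simulating a product law with a uniform message and a uniform seed\<close>

text \<open>
  Elements are laid out in consecutive runs. As runs are short compared with the number of seeds,
  the seed, read off as the position modulo that number, separates positions in the same run.
\<close>
lemma consecutive_filling:
  fixes g :: "'a \<Rightarrow> nat"
  assumes "finite A" "K \<le> (\<Sum>a\<in>A. g a)"
  shows "\<exists>f. (\<forall>j<K. f j \<in> A) \<and> (\<forall>i j. i \<le> j \<longrightarrow> j < K \<longrightarrow> f i = f j \<longrightarrow> j - i < g (f j))"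
  using assms
proof (induction A arbitrary: K rule: finite_induct)
  case (insert a A)
  define L where "L = (\<Sum>a\<in>A. g a)"
  obtain f where f: "\<forall>j<min K L. f j \<in> A"
    "\<And>i j. i \<le> j \<Longrightarrow> j < min K L \<Longrightarrow> f i = f j \<Longrightarrow> j - i < g (f j)"
    using insert.IH[of "min K L"] by (auto simp: L_def)
  have KL: "K \<le> g a + L" using insert by (simp add: L_def)
  \<comment> \<open>The elements of \<open>A\<close> occupy the first \<open>L\<close> positions,
    and the run of \<open>a\<close> takes the at most \<open>g a\<close> positions left.\<close>
  let ?f = "\<lambda>j. if j < L then f j else a"
  have "\<forall>j<K. ?f j \<in> insert a A" using f(1) by auto
  moreover have "j - i < g (?f j)" if "i \<le> j" "j < K" "?f i = ?f j" for i j
  proof (cases "j < L")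
    case True
    then show ?thesis using that f(2)[of i j] by auto
  next
    case False
    then have "\<not> i < L" using that f(1) insert.hyps by (auto split: if_splits)
    then show ?thesis using False that KL by auto
  qed
  ultimately show ?case by (intro exI[of _ ?f] conjI allI impI) blast+
qed auto

text \<open>All positions with value \<open>y\<close> lie in the window of length \<open>g y\<close>
  that starts at the first of them.\<close>

lemma card_run_le:
  fixes f :: "nat \<Rightarrow> 'a"
  assumes "\<And>i j. i \<le> j \<Longrightarrow> j < K \<Longrightarrow> f i = f j \<Longrightarrow> j - i < g (f j)"
  shows "card {j. j < K \<and> f j = y} \<le> g y"
proof (cases "{j. j < K \<and> f j = y} = {}")
  case True
  then show ?thesis by (simp only: card.empty)
next
  case False
  let ?S = "{j. j < K \<and> f j = y}"
  have fin: "finite ?S" by auto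
  define i where "i = Min ?S"
  have i: "i \<in> ?S" using Min_in[OF fin False] by (simp only: i_def)
  have "?S \<subseteq> {i..<i + g y}"
  proof
    fix j assume j: "j \<in> ?S"
    then have "i \<le> j" using Min_le[OF fin j] by (simp add: i_def)
    then show "j \<in> {i..<i + g y}" using assms[of i j] i j by auto
  qed
  from card_mono[OF _ this] show ?thesis by simp
qed

text \<open>There are \<open>M\<close> messages and \<open>2 ^ b\<close> seeds. The last condition
  says that a uniform pair produces an output law at most \<open>1 + \<epsilon>\<close> times the
  product law, cleared of the denominator \<open>M * 2 ^ b\<close>.\<close>

definition block_code ::
  "'y pmf \<Rightarrow> real \<Rightarrow> nat \<Rightarrow> nat \<Rightarrow> nat \<Rightarrow> (nat \<Rightarrow> nat \<Rightarrow> 'y list) \<Rightarrow> bool" where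
  "block_code q \<epsilon> M b k f \<longleftrightarrow>
     (\<forall>w<M. \<forall>v<2 ^ b. length (f w v) = k) \<and> (\<forall>v<2 ^ b. inj_on (\<lambda>w. f w v) {..<M}) \<and>
     (\<forall>y. real (card {(w, v). w < M \<and> v < 2 ^ b \<and> f w v = y}) \<le>
        (1 + \<epsilon>) * (M * 2 ^ b) * pmf (replicate_pmf k q) y)"

text \<open>Here \<open>s\<close> is the half-width of the typical set. By \<open>atypical\<close>
  little mass lies outside it; \<open>long\<close> keeps each word's quota of pairs at most
  \<open>2 ^ b\<close>, so that the seed separates the messages; \<open>seed\<close> makes the
  rounding of the quotas negligible.\<close>

lemma block_code_exists:
  fixes q :: "'y::finite pmf"
  defines "H \<equiv> shannon_entropy q"
  assumes \<epsilon>: "0 < \<epsilon>" "\<epsilon> \<le> 1" and "s > 0"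
    and atypical: "k * info_variance q / s\<^sup>2 \<le> \<epsilon> / 4"
    and long: "2 * real M * 2 powr (s - k * H) \<le> 1"
    and seed: "2 powr (k * H + s) \<le> \<epsilon> / 2 * (M * 2 ^ b)"
  shows "\<exists>f. block_code q \<epsilon> M b k f"
proof -
  let ?Q = "replicate_pmf k q" and ?K = "M * 2 ^ b :: nat"
  define A where "A = {y \<in> set_pmf ?Q. \<bar>info ?Q y - k * H\<bar> < s}"
  have finA: "finite A" by (auto simp: A_def set_replicate_pmf intro: finite_subset[OF _ finite_words[of k]])
  have typical: "2 powr - (k * H + s) \<le> pmf ?Q y" "pmf ?Q y \<le> 2 powr (s - k * H)" if "y \<in> A" for y
    using that by (auto simp: A_def pmf_eq_powr_info intro!: powr_mono)
  \<comment> \<open>The quota of \<open>y\<close>: \<open>1 + \<epsilon>\<close> times its share of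
    the pairs under the product law, rounded down.\<close>
  define g where "g y = nat \<lfloor>(1 + \<epsilon>) * ?K * pmf ?Q y\<rfloor>" for y
  have g_ge: "real (g y) \<ge> (1 + \<epsilon>) * ?K * pmf ?Q y - 1" for y
    unfolding g_def by linarith
  have g_le: "real (g y) \<le> (1 + \<epsilon>) * ?K * pmf ?Q y" for y
    unfolding g_def using \<epsilon> by (intro of_nat_floor) auto
  have g_seed: "g y \<le> 2 ^ b" if "y \<in> A" for y
  proof -
    have "real (g y) \<le> (1 + \<epsilon>) * ?K * 2 powr (s - k * H)"
      using g_le[of y] typical(2)[OF that] \<epsilon> by (meson mult_left_mono order_trans add_nonneg_nonneg less_imp_le mult_nonneg_nonneg of_nat_0_le_iff zero_le_one)
    also have "\<dots> \<le> 2 * real ?K * 2 powr (s - k * H)"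
      by (rule mult_right_mono[OF mult_right_mono]) (use \<epsilon> in auto)
    also have "\<dots> = 2 ^ b * (2 * real M * 2 powr (s - k * H))" by simp
    also have "\<dots> \<le> 2 ^ b * 1" using long by (intro mult_left_mono) auto
    finally have "real (g y) \<le> real (2 ^ b)" by simp
    then show ?thesis by (simp only: of_nat_le_iff)
  qed
  have prob_A: "(\<Sum>y\<in>A. pmf ?Q y) \<ge> 1 - \<epsilon> / 4"
  proof -
    have "measure_pmf.prob ?Q (UNIV - A) = measure_pmf.prob ?Q {y. \<bar>info ?Q y - k * H\<bar> \<ge> s}"
      by (rule measure_pmf.finite_measure_eq_AE) (auto simp: AE_measure_pmf_iff A_def)
    also have "\<dots> \<le> \<epsilon> / 4"
      using order_trans[OF info_concentration[OF \<open>s > 0\<close>] atypical] by (simp add: H_def)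
    finally show ?thesis
      using measure_pmf.prob_compl[of A ?Q] finA by (simp add: measure_measure_pmf_finite)
  qed
  have card_A: "real (card A) \<le> \<epsilon> / 2 * ?K"
  proof -
    have "real (card A) * 2 powr - (k * H + s) = (\<Sum>y\<in>A. 2 powr - (k * H + s))" by simp
    also have "\<dots> \<le> (\<Sum>y\<in>A. pmf ?Q y)" by (intro sum_mono typical)
    also have "\<dots> \<le> 1"
      using measure_pmf.prob_le_1[of ?Q A] finA by (simp add: measure_measure_pmf_finite)
    finally have "real (card A) \<le> 2 powr (k * H + s)"
      by (simp add: powr_diff powr_add powr_minus field_simps)
    also note seed
    finally show ?thesis by simp
  qed
  \<comment> \<open>The total quota reaches \<open>?K\<close>: the inflation pays for the missing
    mass \<open>\<epsilon> / 4\<close> and for the rounding loss of at most one pair per typical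
    word. This is where \<open>\<epsilon> \<le> 1\<close> enters.\<close>
  have "real ?K \<le> (1 + \<epsilon>) * ?K * (1 - \<epsilon> / 4) - \<epsilon> / 2 * ?K"
  proof -
    have "1 \<le> (1 + \<epsilon>) * (1 - \<epsilon> / 4) - \<epsilon> / 2"
      using \<epsilon> mult_left_mono[of \<epsilon> 1 \<epsilon>] by (simp add: algebra_simps)
    from mult_left_mono[OF this, of ?K] show ?thesis by (simp add: algebra_simps)
  qed
  also have "\<dots> \<le> (1 + \<epsilon>) * ?K * (\<Sum>y\<in>A. pmf ?Q y) - card A"
    using \<epsilon> by (intro diff_mono mult_left_mono prob_A card_A) auto
  also have "\<dots> = (\<Sum>y\<in>A. (1 + \<epsilon>) * ?K * pmf ?Q y - 1)"
    by (simp add: sum_subtractf sum_distrib_left)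
  also have "\<dots> \<le> (\<Sum>y\<in>A. real (g y))" by (intro sum_mono g_ge)
  also have "\<dots> = real (\<Sum>y\<in>A. g y)" by (rule of_nat_sum[symmetric])
  finally have "?K \<le> (\<Sum>y\<in>A. g y)" by (simp only: of_nat_le_iff)
  from consecutive_filling[OF finA this] obtain f where
    f: "\<And>j. j < ?K \<Longrightarrow> f j \<in> A" "\<And>i j. i \<le> j \<Longrightarrow> j < ?K \<Longrightarrow> f i = f j \<Longrightarrow> j - i < g (f j)"
    by blast
  let ?F = "\<lambda>w v. f (w * 2 ^ b + v)"
  have lt: "w * 2 ^ b + v < ?K" if "w < M" "v < 2 ^ b" for w v
  proof -
    have "w * 2 ^ b + v < (w + 1) * 2 ^ b" using that by simp
    also have "\<dots> \<le> ?K" using that by (intro mult_right_mono) auto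
    finally show ?thesis .
  qed
  have "length (?F w v) = k" if "w < M" "v < 2 ^ b" for w v
    using f(1)[OF lt[OF that]] by (auto simp: A_def set_replicate_pmf)
  moreover have "inj_on (\<lambda>w. ?F w v) {..<M}" if v: "v < 2 ^ b" for v
  proof (rule linorder_inj_onI)
    fix w w' :: nat assume w: "w < w'" "w' \<in> {..<M}"
    have lt': "w' * 2 ^ b + v < ?K" using lt w v by simp
    \<comment> \<open>Different messages with the same seed are at least \<open>2 ^ b\<close>
      positions apart, too far to lie in one run.\<close>
    have "w * 2 ^ b + 2 ^ b \<le> w' * 2 ^ b"
      using mult_right_mono[of "w + 1" w' "2 ^ b"] w by simp
    then have "w * 2 ^ b + v \<le> w' * 2 ^ b + v" "(w' * 2 ^ b + v) - (w * 2 ^ b + v) \<ge> 2 ^ b"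
      by linarith+
    then show "?F w v \<noteq> ?F w' v"
      using f(2)[of "w * 2 ^ b + v" "w' * 2 ^ b + v"] lt' g_seed[OF f(1)[OF lt']] by auto
  qed auto
  moreover have "real (card {(w, v). w < M \<and> v < 2 ^ b \<and> ?F w v = y}) \<le> (1 + \<epsilon>) * ?K * pmf ?Q y" for y
  proof -
    have "inj_on (\<lambda>(w, v). w * 2 ^ b + v :: nat) {(w, v). w < M \<and> v < 2 ^ b \<and> ?F w v = y}"
    proof (rule inj_on_inverseI[where g = "\<lambda>j. (j div 2 ^ b, j mod 2 ^ b)"])
    qed auto
    then have "card {(w, v). w < M \<and> v < 2 ^ b \<and> ?F w v = y} \<le> card {j. j < ?K \<and> f j = y}"
      by (rule card_inj_on_le) (use lt in auto)
    also have "\<dots> \<le> g y" by (rule card_run_le) (rule f(2))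
    finally show ?thesis using g_le[of y] by linarith
  qed
  ultimately show ?thesis unfolding block_code_def by (intro exI[of _ ?F]) auto
qed

section \<open>A zero-error universal code\<close>

lemma finite_types: "finite (mset ` {xs :: 'x::finite list. length xs = n})"
  by (intro finite_imageI finite_words)

text \<open>A type is determined by its letter counts, each of which is at most
  \<open>n\<close>.\<close>

lemma card_types_le: "card (mset ` {xs :: 'x::finite list. length xs = n}) \<le> (n + 1) ^ CARD('x)"
proof -
  let ?T = "mset ` {xs :: 'x list. length xs = n}" and ?F = "(UNIV :: 'x set) \<rightarrow>\<^sub>E {..n}"
  have "inj_on count ?T" by (auto simp: inj_on_def multiset_eq_iff)
  moreover have "count ` ?T \<subseteq> ?F"
    by (auto simp: PiE_UNIV_domain) (metis count_le_size size_mset)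
  ultimately have "card ?T \<le> card ?F" by (rule card_inj_on_le) (simp add: finite_PiE)
  then show ?thesis by (simp add: card_PiE)
qed

section \<open>Assembling the code from a type block and a position block\<close>

text \<open>Given the type, the padded type index and the position in the type class are independent
  and uniform for every source law. Hence the output law given the type is at most
  \<open>(1 + \<epsilon>)\<^sup>2\<close> times the product law, a bound that survives mixing over
  types with the same output length.\<close>

lemma universal_code_from_blocks:
  fixes q :: "'y::finite pmf" and k2 :: "'x::finite multiset \<Rightarrow> nat"
  assumes B1: "block_code q \<epsilon> (2 ^ a) b k1 f1"
    and B2: "\<And>t. size t = n \<Longrightarrow> block_code q \<epsilon> (card (permutations_of_multiset t)) b (k2 t) (f2 t)"
    and types: "card (mset ` {xs :: 'x list. length xs = n}) \<le> 2 ^ a"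
    and "\<epsilon> \<ge> 0"
  shows "\<exists>C :: ('x, 'y) covert_code. is_code n C \<and> seed_length C = a + 2 * b \<and>
     out_length C = (\<lambda>x. k1 + k2 (mset x)) \<and> (\<forall>p. error_prob n p C = 0) \<and>
     (\<forall>p. \<forall>x\<in>set_pmf (replicate_pmf n p). covertness n p q C x \<le> ereal (log 2 ((1 + \<epsilon>)\<^sup>2)))"
proof -
  let ?T = "mset ` {xs :: 'x list. length xs = n}" and ?N = "2 ^ a :: nat"
  define cls :: "'x multiset \<Rightarrow> 'x list set" where "cls = permutations_of_multiset"
  have cls: "x \<in> cls t \<longleftrightarrow> mset x = t" for x t by (simp add: cls_def permutations_of_multiset_def)
  have finc: "finite (cls t)" for t by (simp add: cls_def)
  obtain \<tau> where "bij_betw \<tau> ?T {0..<card ?T}"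
    using ex_bij_betw_finite_nat[OF finite_types] by blast
  then have \<tau>: "inj_on \<tau> ?T" by (simp add: bij_betw_def)
  have \<tau>_less: "\<tau> t < ?N" if "t \<in> ?T" for t
    using bij_betwE[OF \<open>bij_betw \<tau> _ _\<close>] that types by fastforce
  have "\<forall>t. \<exists>i. bij_betw i (cls t) {0..<card (cls t)}"
    using ex_bij_betw_finite_nat[OF finc] by blast
  then obtain \<iota> where \<iota>: "\<And>t. bij_betw (\<iota> t) (cls t) {0..<card (cls t)}" by metis
  \<comment> \<open>A seed of \<open>a + 2 * b\<close> bits is read through \<open>h\<close> as a
    triple: the pad for the type index and one seed for each block.\<close>
  let ?S = "{..<?N} \<times> {..<2 ^ b :: nat} \<times> {..<2 ^ b :: nat}" and ?U = "{1..2 ^ (a + 2 * b) :: nat}"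
  have "card ?U = card ?S" by (simp add: card_cartesian_product power_add mult_2)
  then obtain h where h: "bij_betw h ?U ?S"
    using finite_same_card_bij[of ?U ?S] by auto
  define enc where "enc x u = (case h u of (z, v1, v2) \<Rightarrow>
    f1 ((\<tau> (mset x) + z) mod ?N) v1 @ f2 (mset x) (\<iota> (mset x) x) v2)" for x u
  \<comment> \<open>Off the range of the encoder, the default only has to have the length
    \<open>n\<close> that \<open>is_code\<close> demands.\<close>
  define dec where "dec y u = (if \<exists>x. length x = n \<and> enc x u = y
    then (SOME x. length x = n \<and> enc x u = y) else replicate n undefined)" for y u
  define C :: "('x, 'y) covert_code" where
    "C = \<lparr>seed_length = a + 2 * b, out_length = (\<lambda>x. k1 + k2 (mset x)), encode = enc, decode = dec\<rparr>"
  have seeds: "seeds C = ?U" by (simp add: seeds_def C_def)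
  have hu: "\<exists>z v1 v2. h u = (z, v1, v2) \<and> z < ?N \<and> v1 < 2 ^ b \<and> v2 < 2 ^ b" if "u \<in> ?U" for u
    using bij_betwE[OF h] that by fastforce
  have ix: "\<iota> (mset x) x < card (cls (mset x))" for x
    using bij_betwE[OF \<iota>[of "mset x"]] by (auto simp: cls)
  have len1: "length (f1 w v) = k1" if "w < ?N" "v < 2 ^ b" for w v
    using B1 that by (simp add: block_code_def)
  have len2: "length (f2 (mset x) w v) = k2 (mset x)"
    if "length x = n" "w < card (cls (mset x))" "v < 2 ^ b" for x w v
    using B2[of "mset x"] that by (simp add: block_code_def cls_def)
  have inj1: "w = w'" if "f1 w v = f1 w' v" "w < ?N" "w' < ?N" "v < 2 ^ b" for w w' v
    using B1 that unfolding block_code_def inj_on_def by blast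
  have inj2: "w = w'" if "f2 (mset x) w v = f2 (mset x) w' v" "length x = n"
    "w < card (cls (mset x))" "w' < card (cls (mset x))" "v < 2 ^ b" for w w' v x
    using B2[of "mset x"] that unfolding block_code_def inj_on_def cls_def by (simp add: Ball_def)
  have shift_le: "i = j" if "(i + z) mod ?N = (j + z) mod ?N" "j < ?N" "i \<le> j" for i j z
    using mod_eq_dvd_iff_nat[of "i + z" "j + z" ?N] that by (auto dest: dvd_imp_le)
  then have shift: "i = j" if "(i + z) mod ?N = (j + z) mod ?N" "i < ?N" "j < ?N" for i j z
    using that by (metis nat_le_linear)
  have enc_length: "length (enc x u) = k1 + k2 (mset x)" if "length x = n" "u \<in> ?U" for x u
    using hu[OF that(2)] len1 len2[OF that(1) ix] by (auto simp: enc_def)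
  have enc_inj: "x = x'" if "enc x u = enc x' u" "length x = n" "length x' = n" "u \<in> ?U" for x x' u
  proof -
    from hu[OF that(4)] obtain z v1 v2 where u: "h u = (z, v1, v2)" "v1 < 2 ^ b" "v2 < 2 ^ b" by blast
    let ?w = "\<lambda>x. (\<tau> (mset x) + z) mod ?N"
    \<comment> \<open>The first block has the fixed length \<open>k1\<close>, so the output can be
      split before the type is known; the type recovered from it then tells how to read the second
      block.\<close>
    have "length (f1 (?w x) v1) = k1" "length (f1 (?w x') v1) = k1" using u(2) by (simp_all add: len1)
    then have eq: "f1 (?w x) v1 = f1 (?w x') v1"
      "f2 (mset x) (\<iota> (mset x) x) v2 = f2 (mset x') (\<iota> (mset x') x') v2"
      using that(1) by (simp_all add: enc_def u(1))
    have "?w x = ?w x'" by (rule inj1[OF eq(1)]) (use u in auto)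
    then have "\<tau> (mset x) = \<tau> (mset x')"
      by (rule shift) (use \<tau>_less that in auto)
    then have m: "mset x = mset x'" using \<tau> that by (auto dest: inj_onD)
    then have "\<iota> (mset x) x = \<iota> (mset x) x'"
      using inj2[OF eq(2)[folded m]] that(2) ix[of x] ix[of x'] u(3) by simp
    then show ?thesis
      using \<iota>[of "mset x"] m by (auto simp: bij_betw_def cls dest: inj_onD)
  qed
  have dec_enc: "dec (enc x u) u = x" if "length x = n" "u \<in> ?U" for x u
  proof -
    have "length (SOME x'. length x' = n \<and> enc x' u = enc x u) = n \<and>
        enc (SOME x'. length x' = n \<and> enc x' u = enc x u) u = enc x u"
      by (rule someI[where P = "\<lambda>x'. length x' = n \<and> enc x' u = enc x u" and x = x]) (use that in simp)
    then show ?thesis using enc_inj that by (auto simp: dec_def)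
  qed
  have dec_length: "length (dec y u) = n" for y u
  proof (cases "\<exists>x. length x = n \<and> enc x u = y")
    case True
    from someI_ex[OF this] True show ?thesis by (simp add: dec_def)
  qed (auto simp: dec_def)
  have code: "is_code n C"
    using enc_length dec_length by (simp add: is_code_def seeds) (simp add: C_def)
  have no_error: "error_prob n p C = 0" for p
  proof -
    have "AE (x, u) in measure_pmf (source_seed_pmf n p C). x = dec (enc x u) u"
      using dec_enc by (auto simp: AE_measure_pmf_iff set_source_seed_pmf set_replicate_pmf seeds)
    then show ?thesis
      unfolding error_prob_def
      by (subst measure_pmf.prob_eq_0) (auto simp: C_def case_prod_unfold)
  qed
  \<comment> \<open>For a fixed type, the word and the seed are determined by the two block messages
    and the two block seeds, the pad being recoverable from the shifted index. So the fibre over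
    \<open>y\<close> injects into the product of the two block fibres.\<close>
  have fibre: "real (card {(x, u). mset x = t \<and> u \<in> ?U \<and> enc x u = y}) \<le>
      (1 + \<epsilon>)\<^sup>2 * (card (cls t) * 2 ^ (a + 2 * b)) * pmf (replicate_pmf (k1 + k2 t) q) y"
    (is "real (card ?E) \<le> ?R") if t: "size t = n" for t y
  proof (cases "?E = {}")
    case True
    then show ?thesis using \<open>\<epsilon> \<ge> 0\<close> by (simp only: card.empty) (simp del: replicate_pmf.simps)
  next
    case False
    then obtain x0 u0 where x0: "mset x0 = t" "u0 \<in> ?U" "enc x0 u0 = y" by blast
    then have y: "length y = k1 + k2 t" using enc_length[of x0 u0] t by (metis size_mset)
    let ?E1 = "{(w, v). w < ?N \<and> v < 2 ^ b \<and> f1 w v = take k1 y}"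
    let ?E2 = "{(w, v). w < card (cls t) \<and> v < 2 ^ b \<and> f2 t w v = drop k1 y}"
    let ?\<phi> = "\<lambda>(x, u). case h u of (z, v1, v2) \<Rightarrow> (((\<tau> t + z) mod ?N, v1), (\<iota> t x, v2))"
    have fin: "finite (?E1 \<times> ?E2)"
      by (rule finite_subset[of _ "({..<?N} \<times> {..<2 ^ b}) \<times> ({..<card (cls t)} \<times> {..<2 ^ b})"]) auto
    have "inj_on ?\<phi> ?E"
    proof (rule inj_onI)
      fix e e' assume e: "e \<in> ?E" "e' \<in> ?E" "?\<phi> e = ?\<phi> e'"
      obtain x u x' u' where xu: "e = (x, u)" "e' = (x', u')" by fastforce
      have U: "u \<in> ?U" "u' \<in> ?U" and cls': "x \<in> cls t" "x' \<in> cls t" using e xu by (auto simp: cls)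
      obtain z v1 v2 where u: "h u = (z, v1, v2)" "z < ?N" using hu[OF U(1)] by blast
      obtain z' v1' v2' where u': "h u' = (z', v1', v2')" "z' < ?N" using hu[OF U(2)] by blast
      have eq: "(z + \<tau> t) mod ?N = (z' + \<tau> t) mod ?N" "v1 = v1'" "v2 = v2'" "\<iota> t x = \<iota> t x'"
        using e(3) by (simp_all add: xu u(1) u'(1) add.commute)
      have "h u = h u'" using shift[OF eq(1) u(2) u'(2)] eq by (simp add: u(1) u'(1))
      then have "u = u'" using h U by (auto simp: bij_betw_def dest: inj_onD)
      moreover have "x = x'" using \<iota>[of t] eq(4) cls' by (auto simp: bij_betw_def dest: inj_onD)
      ultimately show "e = e'" by (simp add: xu)
    qed
    moreover have "?\<phi> ` ?E \<subseteq> ?E1 \<times> ?E2"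
    proof -
      have "?\<phi> (x, u) \<in> ?E1 \<times> ?E2" if xu: "mset x = t" "u \<in> ?U" "enc x u = y" for x u
      proof -
        from hu[OF xu(2)] obtain z v1 v2 where u: "h u = (z, v1, v2)" "v1 < 2 ^ b" "v2 < 2 ^ b" by blast
        have "y = f1 ((\<tau> t + z) mod ?N) v1 @ f2 t (\<iota> t x) v2"
          using xu by (simp add: enc_def u(1))
        moreover have "length (f1 ((\<tau> t + z) mod ?N) v1) = k1" using u(2) by (simp add: len1)
        ultimately show ?thesis using u ix[of x] xu(1) by auto
      qed
      then show ?thesis by blast
    qed
    ultimately have "card ?E \<le> card (?E1 \<times> ?E2)" by (rule card_inj_on_le) (rule fin)
    then have "real (card ?E) \<le> real (card ?E1) * real (card ?E2)"
      unfolding card_cartesian_product of_nat_mult[symmetric] of_nat_le_iff .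
    also have "\<dots> \<le> ((1 + \<epsilon>) * (?N * 2 ^ b) * pmf (replicate_pmf k1 q) (take k1 y)) *
        ((1 + \<epsilon>) * (card (cls t) * 2 ^ b) * pmf (replicate_pmf (k2 t) q) (drop k1 y))"
      using B1 B2[OF t] \<open>\<epsilon> \<ge> 0\<close> by (intro mult_mono) (auto simp: block_code_def cls_def)
    also have "\<dots> = (1 + \<epsilon>)\<^sup>2 * (card (cls t) * 2 ^ (a + 2 * b)) *
        (pmf (replicate_pmf k1 q) (take k1 y) * pmf (replicate_pmf (k2 t) q) (drop k1 y))"
      by (simp add: power2_eq_square power_add mult_2)
    also have "pmf (replicate_pmf k1 q) (take k1 y) * pmf (replicate_pmf (k2 t) q) (drop k1 y) =
        pmf (replicate_pmf (k1 + k2 t) q) y"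
      using pmf_replicate_pmf_append[of "take k1 y" q "drop k1 y"] y by simp
    finally show ?thesis .
  qed
  have covert: "covertness n p q C x0 \<le> ereal (log 2 ((1 + \<epsilon>)\<^sup>2))"
    if x0: "x0 \<in> set_pmf (replicate_pmf n p)" for p x0
  proof -
    let ?D = "source_seed_pmf n p C" and ?P = "replicate_pmf n p"
    define k where "k = out_length C x0"
    let ?Q = "replicate_pmf k q" and ?Tk = "{t \<in> ?T. k1 + k2 t = k}"
    have out: "out_length C x = k1 + k2 (mset x)" for x by (simp add: C_def)
    have encC: "encode C = enc" by (simp add: C_def)
    have finTk: "finite ?Tk" by (rule finite_subset[OF _ finite_types[of n]]) blast
    \<comment> \<open>All words of a type class are equally likely, which turns the fibre count into
      a probability.\<close>
    have per_type: "measure_pmf.prob ?D {(x, u). mset x = t \<and> enc x u = y} \<le>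
        measure_pmf.prob ?P {x. mset x = t} * ((1 + \<epsilon>)\<^sup>2 * pmf ?Q y)" if t: "t \<in> ?Tk" for t y
    proof -
      let ?E = "{(x, u). mset x = t \<and> u \<in> ?U \<and> enc x u = y}"
      from t obtain x1 where x1: "length x1 = n" "mset x1 = t" by auto
      have finE: "finite ?E"
        by (rule finite_subset[of _ "cls t \<times> ?U"]) (use finc cls in auto)
      have "measure_pmf.prob ?D {(x, u). mset x = t \<and> enc x u = y} = measure_pmf.prob ?D ?E"
        by (rule measure_pmf.finite_measure_eq_AE) (auto simp: AE_measure_pmf_iff set_source_seed_pmf seeds)
      also have "\<dots> = (\<Sum>(x, u)\<in>?E. pmf ?D (x, u))"
        using finE by (subst measure_measure_pmf_finite) (auto intro!: sum.cong)
      also have "\<dots> = (\<Sum>(x, u)\<in>?E. pmf ?P x1 / 2 ^ (a + 2 * b))"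
      proof (rule sum.cong[OF refl], clarify)
        fix x u assume xu: "u \<in> ?U" and "t = mset x"
        then have "pmf ?P x = pmf ?P x1" using x1 by (intro pmf_replicate_pmf_mset) simp
        then show "pmf ?D (x, u) = pmf ?P x1 / 2 ^ (a + 2 * b)"
          using xu by (simp add: source_seed_pmf_def pmf_pair seeds)
      qed
      also have "\<dots> = card ?E * (pmf ?P x1 / 2 ^ (a + 2 * b))" by (simp add: case_prod_unfold)
      also have "\<dots> \<le> ((1 + \<epsilon>)\<^sup>2 * (card (cls t) * 2 ^ (a + 2 * b)) * pmf ?Q y) * (pmf ?P x1 / 2 ^ (a + 2 * b))"
        using fibre[of t y] t x1 by (intro mult_right_mono) auto
      also have "\<dots> = (card (cls t) * pmf ?P x1) * ((1 + \<epsilon>)\<^sup>2 * pmf ?Q y)" by simp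
      also have "card (cls t) * pmf ?P x1 = (\<Sum>x\<in>cls t. pmf ?P x)"
      proof -
        have "(\<Sum>x\<in>cls t. pmf ?P x) = (\<Sum>x\<in>cls t. pmf ?P x1)"
          using x1 by (intro sum.cong refl pmf_replicate_pmf_mset) (simp add: cls)
        then show ?thesis by simp
      qed
      also have "\<dots> = measure_pmf.prob ?P {x. mset x = t}"
        using finc[of t] cls by (subst measure_measure_pmf_finite[symmetric]) (auto intro: arg_cong[where f = "measure_pmf.prob ?P"])
      finally show ?thesis .
    qed
    have prob_k: "measure_pmf.prob ?P {x. out_length C x = k} = (\<Sum>t\<in>?Tk. measure_pmf.prob ?P {x. mset x = t})"
    proof -
      have "measure_pmf.prob ?P {x. out_length C x = k} = measure_pmf.prob ?P (\<Union>t\<in>?Tk. {x. mset x = t})"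
        by (rule measure_pmf.finite_measure_eq_AE) (auto simp: AE_measure_pmf_iff set_replicate_pmf out)
      also have "\<dots> = (\<Sum>t\<in>?Tk. measure_pmf.prob ?P {x. mset x = t})"
        by (rule measure_pmf.finite_measure_finite_Union) (use finTk in \<open>auto simp: disjoint_family_on_def\<close>)
      finally show ?thesis .
    qed
    \<comment> \<open>Several types may share the length \<open>k\<close>; their bounds are added
      with the type probabilities as weights.\<close>
    have "pmf (output_pmf n p C k) y \<le> (1 + \<epsilon>)\<^sup>2 * pmf ?Q y" for y
    proof -
      have "measure_pmf.prob ?P {x. out_length C x = k} * pmf (output_pmf n p C k) y =
          measure_pmf.prob ?D {(x, u). out_length C x = k \<and> enc x u \<in> {y}}"
        using prob_output_pmf[OF x0, of C "{y}"] by (simp add: k_def encC measure_pmf_single)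
      also have "\<dots> \<le> measure_pmf.prob ?D (\<Union>t\<in>?Tk. {(x, u). mset x = t \<and> enc x u = y})"
        by (rule measure_pmf.finite_measure_mono_AE)
          (auto simp: AE_measure_pmf_iff set_source_seed_pmf set_replicate_pmf out)
      also have "\<dots> \<le> (\<Sum>t\<in>?Tk. measure_pmf.prob ?D {(x, u). mset x = t \<and> enc x u = y})"
        by (rule measure_pmf.finite_measure_subadditive_finite) (use finTk in auto)
      also have "\<dots> \<le> (\<Sum>t\<in>?Tk. measure_pmf.prob ?P {x. mset x = t} * ((1 + \<epsilon>)\<^sup>2 * pmf ?Q y))"
        by (rule sum_mono) (rule per_type)
      also have "\<dots> = measure_pmf.prob ?P {x. out_length C x = k} * ((1 + \<epsilon>)\<^sup>2 * pmf ?Q y)"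
        by (simp add: prob_k sum_distrib_right)
      finally show ?thesis
        using measure_pmf_posI[OF x0, of "{x. out_length C x = k}"] by (simp add: k_def)
    qed
    from KL_div_le_log_ratio[OF finite_set_output_pmf[OF x0, of C, folded k_def] this]
    show ?thesis by (simp add: covertness_def k_def)
  qed
  show ?thesis
    using code no_error covert by (intro exI[of _ C]) (auto simp: C_def)
qed

section \<open>Achievability\<close>

text \<open>
  The slack has to exceed the fluctuations of order \<open>sqrt n\<close> of the information content and to be
  \<open>o(n)\<close>; the tolerance has to dominate the resulting Chebyshev bound of order \<open>n / (slack n)\<^sup>2\<close>.
\<close>
definition slack :: "nat \<Rightarrow> real" where
  "slack n = real n powr (3 / 4)"

definition tol :: "nat \<Rightarrow> real" where
  "tol n = real n powr (- 1 / 4)"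

text \<open>The factor 3 leaves room above the exponent \<open>2 * slack n + 1 + H\<close> that the
  hypothesis \<open>seed\<close> of \<open>block_code_exists\<close> requires, up to the factor
  \<open>tol n / 2\<close>.\<close>

definition seed_bits :: "nat \<Rightarrow> nat" where
  "seed_bits n = nat \<lceil>3 * slack n\<rceil>"

text \<open>Enough bits to index the types of words of length \<open>n\<close> over \<open>c\<close>
  letters.\<close>

definition type_bits :: "nat \<Rightarrow> nat \<Rightarrow> nat" where
  "type_bits c n = nat \<lceil>c * log 2 (real n + 1)\<rceil>"

text \<open>For \<open>H > 0\<close> and \<open>M \<ge> 1\<close>, the least length that satisfies
  the hypothesis \<open>long\<close> of \<open>block_code_exists\<close> with
  \<open>s = slack n\<close>; the summand 1 stems from the factor 2 there.\<close>

definition block_length :: "real \<Rightarrow> nat \<Rightarrow> nat \<Rightarrow> nat" where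
  "block_length H n M = nat \<lceil>(log 2 M + slack n + 1) / H\<rceil>"

lemma block_length_bounds:
  fixes H :: real
  assumes "H > 0" "M \<ge> 1"
  shows "log 2 M + slack n + 1 \<le> block_length H n M * H"
    and "block_length H n M * H \<le> log 2 M + slack n + 1 + H"
proof -
  let ?r = "(log 2 M + slack n + 1) / H"
  have r: "?r \<ge> 0" using assms by (simp add: slack_def)
  then have "?r \<le> block_length H n M" "block_length H n M \<le> ?r + 1"
    unfolding block_length_def by linarith+
  then show "log 2 M + slack n + 1 \<le> block_length H n M * H"
    "block_length H n M * H \<le> log 2 M + slack n + 1 + H"
    using assms by (simp_all add: field_simps)
qed

text \<open>Since \<open>log 2 M\<close> is at most linear in \<open>n\<close>, so is the block
  length, and the hypotheses of \<open>block_code_exists\<close> hold from some \<open>n\<close> on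
  for all such \<open>M\<close> at once. This uniformity is needed because the type classes of one
  \<open>n\<close> have different sizes.\<close>

lemma eventually_block_code_exists:
  fixes q :: "'y::finite pmf" and c :: real
  defines "H \<equiv> shannon_entropy q"
  assumes H: "H > 0" and c: "c > 0"
  shows "\<forall>\<^sub>F n in sequentially. \<forall>M. 1 \<le> M \<longrightarrow> log 2 M \<le> c * n \<longrightarrow>
    (\<exists>f. block_code q (tol n) M (seed_bits n) (block_length H n M) f)"
proof -
  \<comment> \<open>A strictly positive bound on the variance avoids a separate asymptotic analysis
    for variance zero.\<close>
  define V where "V = info_variance q + 1"
  have V: "V > 0" using info_variance_nonneg[of q] by (simp add: V_def)
  have "\<forall>\<^sub>F n in sequentially. (c * n + slack n + 1 + H) / H * V / (slack n)\<^sup>2 \<le> tol n / 4"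
    unfolding slack_def tol_def using H c V by real_asymp
  moreover have "\<forall>\<^sub>F n in sequentially. 2 powr (2 * slack n + 1 + H) \<le> tol n / 2 * 2 powr (3 * slack n)"
    unfolding slack_def tol_def using H by real_asymp
  ultimately show ?thesis
    using eventually_gt_at_top[of 0]
  proof eventually_elim
    case (elim n)
    show ?case
    proof (intro allI impI)
      fix M :: nat assume M: "1 \<le> M" "log 2 M \<le> c * n"
      let ?k = "block_length H n M"
      note k = block_length_bounds[OF H M(1), of n]
      have s: "slack n > 0" using elim by (simp add: slack_def)
      have Mpow: "real M = 2 powr log 2 M" using M by simp
      show "\<exists>f. block_code q (tol n) M (seed_bits n) ?k f"
      proof (rule block_code_exists[OF _ _ s], fold H_def)
        show "0 < tol n" using elim by (simp add: tol_def)
        show "tol n \<le> 1" using elim by (auto simp: tol_def powr_minus_divide intro!: ge_one_powr_ge_zero)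
        have "real ?k \<le> (c * n + slack n + 1 + H) / H"
          using k(2) M(2) H by (simp add: pos_le_divide_eq)
        then have "?k * info_variance q / (slack n)\<^sup>2 \<le> (c * n + slack n + 1 + H) / H * V / (slack n)\<^sup>2"
          using info_variance_nonneg[of q]
          by (intro divide_right_mono mult_mono) (auto simp: V_def intro: order_trans[OF of_nat_0_le_iff])
        also note elim(1)
        finally show "?k * info_variance q / (slack n)\<^sup>2 \<le> tol n / 4" .
        have "2 * real M * 2 powr (slack n - ?k * H) = 2 powr (1 + log 2 M + (slack n - ?k * H))"
          using Mpow by (simp add: powr_add)
        also have "\<dots> \<le> 2 powr 0" using k(1) by (intro powr_mono) auto
        finally show "2 * real M * 2 powr (slack n - ?k * H) \<le> 1" by simp
        have "2 powr (?k * H + slack n) \<le> 2 powr (log 2 M + (2 * slack n + 1 + H))"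
          using k(2) by (intro powr_mono) auto
        also have "\<dots> = M * 2 powr (2 * slack n + 1 + H)"
          using Mpow by (simp only: powr_add[of 2 "log 2 M"])
        also have "\<dots> \<le> M * (tol n / 2 * 2 powr (3 * slack n))"
          by (rule mult_left_mono[OF elim(2)]) simp
        also have "\<dots> \<le> M * (tol n / 2 * 2 powr (seed_bits n))"
        proof -
          have "3 * slack n \<le> seed_bits n" unfolding seed_bits_def by linarith
          then show ?thesis by (intro mult_left_mono powr_mono) (auto simp: tol_def)
        qed
        also have "\<dots> = tol n / 2 * (M * 2 ^ seed_bits n)" by (simp add: powr_realpow)
        finally show "2 powr (?k * H + slack n) \<le> tol n / 2 * (M * 2 ^ seed_bits n)" .
      qed
    qed
  qed
qed

section \<open>The universal code for a single block length\<close>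

text \<open>The source laws are quantified inside, so one code serves them all; the output length
  depends on the source word only through the size of its type class.\<close>

definition code_spec :: "'y::finite pmf \<Rightarrow> nat \<Rightarrow> ('x::finite, 'y) covert_code \<Rightarrow> bool" where
  "code_spec q n C \<longleftrightarrow> is_code n C \<and>
     seed_length C = type_bits CARD('x) n + 2 * seed_bits n \<and>
     out_length C = (\<lambda>x. block_length (shannon_entropy q) n (2 ^ type_bits CARD('x) n) +
       block_length (shannon_entropy q) n (card (permutations_of_multiset (mset x)))) \<and>
     (\<forall>p. error_prob n p C = 0) \<and>
     (\<forall>p. \<forall>x\<in>set_pmf (replicate_pmf n p). covertness n p q C x \<le> ereal (log 2 ((1 + tol n)\<^sup>2)))"

lemma type_bits_bounds:
  shows "(n + 1) ^ c \<le> 2 ^ type_bits c n" and "type_bits c n \<le> c * log 2 (real n + 1) + 1"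
proof -
  have nn: "c * log 2 (real n + 1) \<ge> 0" by simp
  have "real ((n + 1) ^ c) = (real n + 1) powr c" by (simp add: powr_realpow add.commute)
  also have "\<dots> = 2 powr (log 2 (real n + 1) * c)" by (simp add: powr_powr[symmetric])
  also have "\<dots> \<le> 2 powr (type_bits c n)"
    by (intro powr_mono) (simp_all add: type_bits_def mult.commute real_nat_ceiling_ge)
  also have "\<dots> = real (2 ^ type_bits c n)" by (simp add: powr_realpow)
  finally show "(n + 1) ^ c \<le> 2 ^ type_bits c n" by (simp only: of_nat_le_iff)
  show "type_bits c n \<le> c * log 2 (real n + 1) + 1" using nn unfolding type_bits_def by linarith
qed

lemma permutations_of_multiset_pos: "card (permutations_of_multiset t) \<ge> 1"
proof -
  have "permutations_of_multiset t \<noteq> {}"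
    by (metis empty_iff ex_mset permutations_of_multisetI)
  then show ?thesis by (simp add: Suc_le_eq card_gt_0_iff)
qed

text \<open>A crude linear bound that brings all type classes within the range of
  \<open>eventually_block_code_exists\<close>.\<close>

lemma log_card_class_le:
  assumes "size (t :: 'x::finite multiset) = n"
  shows "log 2 (card (permutations_of_multiset t)) \<le> log 2 CARD('x) * n"
proof -
  have "permutations_of_multiset t \<subseteq> {xs. length xs = n}"
    using assms by (auto simp: permutations_of_multiset_def)
  then have "card (permutations_of_multiset t) \<le> card {xs :: 'x list. length xs = n}"
    by (intro card_mono finite_words)
  also have "\<dots> = CARD('x) ^ n" using card_lists_length_eq[of "UNIV :: 'x set" n] by simp
  finally have "real (card (permutations_of_multiset t)) \<le> real CARD('x) ^ n"
    by (metis of_nat_le_iff of_nat_power)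
  then have "log 2 (card (permutations_of_multiset t)) \<le> log 2 (real CARD('x) ^ n)"
    using permutations_of_multiset_pos[of t] by (intro log_mono) auto
  then show ?thesis by (simp add: log_nat_power mult.commute)
qed

text \<open>The words of the class all have the probability of \<open>x\<close>, and together at
  most 1. This is how the length adapts to an unknown source entropy.\<close>

lemma log_card_class_le_info:
  assumes "x \<in> set_pmf (replicate_pmf n p)"
  shows "log 2 (card (permutations_of_multiset (mset x))) \<le> info (replicate_pmf n p) x"
proof -
  let ?P = "replicate_pmf n p"
  have pos: "pmf ?P x > 0" using assms by (rule pmf_positive)
  have "real (card (permutations_of_multiset (mset x))) \<le> 1 / pmf ?P x"
    by (rule card_high_probability(2)[where p = ?P])
      (use pos pmf_replicate_pmf_mset in \<open>force simp: permutations_of_multiset_def\<close>)+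
  also have "\<dots> = 2 powr info ?P x" using pos by (simp add: info_def powr_minus_divide)
  finally show ?thesis
    using permutations_of_multiset_pos[of "mset x"] by (subst log_le_iff) auto
qed

lemma eventually_code_spec:
  fixes q :: "'y::finite pmf"
  assumes H: "shannon_entropy q > 0"
  shows "\<forall>\<^sub>F n in sequentially. \<exists>C :: ('x::finite, 'y) covert_code. code_spec q n C"
proof -
  \<comment> \<open>The added 1 makes \<open>c * n\<close> at least \<open>n\<close>, which
    eventually bounds the number of type bits; the logarithm takes care of the type classes.\<close>
  define c where "c = log 2 CARD('x) + 1"
  have c: "c \<ge> 1" by (simp add: c_def Suc_le_eq)
  have "\<forall>\<^sub>F n in sequentially. real CARD('x) * log 2 (real n + 1) + 1 \<le> real n"
    by real_asymp
  moreover have "\<forall>\<^sub>F n in sequentially. \<forall>M. 1 \<le> M \<longrightarrow> log 2 M \<le> c * n \<longrightarrow>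
      (\<exists>f. block_code q (tol n) M (seed_bits n) (block_length (shannon_entropy q) n M) f)"
    using eventually_block_code_exists[OF H, of c] c by simp
  ultimately show ?thesis
  proof eventually_elim
    case (elim n)
    note small = elim(1) and blocks = elim(2)
    let ?k = "block_length (shannon_entropy q) n" and ?a = "type_bits CARD('x) n"
    have "log 2 (2 ^ ?a) \<le> c * n"
      using type_bits_bounds(2)[of "CARD('x)" n] small c mult_right_mono[of 1 c "real n"]
      by simp
    then obtain f1 where f1: "block_code q (tol n) (2 ^ ?a) (seed_bits n) (?k (2 ^ ?a)) f1"
      using blocks[rule_format, of "2 ^ ?a"] by auto
    have "\<exists>f. size t = n \<longrightarrow> block_code q (tol n) (card (permutations_of_multiset t)) (seed_bits n)
        (?k (card (permutations_of_multiset t))) f" for t :: "'x multiset"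
    proof (cases "size t = n")
      case True
      have "log 2 CARD('x) * n \<le> c * n" by (intro mult_right_mono) (auto simp: c_def)
      then have "log 2 (card (permutations_of_multiset t)) \<le> c * n"
        using log_card_class_le[OF True] by linarith
      then show ?thesis using blocks permutations_of_multiset_pos[of t] by auto
    qed auto
    then obtain f2 where "\<And>t :: 'x multiset. size t = n \<Longrightarrow> block_code q (tol n) (card (permutations_of_multiset t)) (seed_bits n)
        (?k (card (permutations_of_multiset t))) (f2 t)"
      by metis
    from universal_code_from_blocks[where ?k2.0 = "\<lambda>t. ?k (card (permutations_of_multiset t))",
      OF f1 this order_trans[OF card_types_le type_bits_bounds(1)]]
    show "\<exists>C :: ('x, 'y) covert_code. code_spec q n C"
      by (simp add: code_spec_def tol_def)
  qed
qed

section \<open>Asymptotics of the constructed code\<close>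

lemma p_limI_real:
  fixes Z :: "nat \<Rightarrow> 'a \<Rightarrow> real"
  assumes upper: "\<And>e. e > 0 \<Longrightarrow> (\<lambda>n. measure_pmf.prob (P n) {w. Z n w \<ge> L + e}) \<longlonglongrightarrow> 0"
    and lower: "\<And>e. e > 0 \<Longrightarrow> (\<lambda>n. measure_pmf.prob (P n) {w. Z n w \<le> L - e}) \<longlonglongrightarrow> 0"
  shows "p_lim P Z L"
  unfolding p_lim_def
proof (intro allI impI)
  fix S :: "real set" assume "open S" "L \<in> S"
  then obtain e where e: "e > 0" "\<And>y. dist y L < e \<Longrightarrow> y \<in> S" by (auto simp: open_dist)
  have "Z n w \<ge> L + e \<or> Z n w \<le> L - e" if "Z n w \<notin> S" for n w
    using e(2)[of "Z n w"] that unfolding dist_real_def by linarith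
  then have "{w. Z n w \<notin> S} \<subseteq> {w. Z n w \<ge> L + e} \<union> {w. Z n w \<le> L - e}" for n
    by blast
  then have "measure_pmf.prob (P n) {w. Z n w \<notin> S} \<le>
      measure_pmf.prob (P n) {w. Z n w \<ge> L + e} + measure_pmf.prob (P n) {w. Z n w \<le> L - e}" for n
    by (rule order_trans[OF measure_pmf.finite_measure_mono measure_Un_le]) simp_all
  note bound = this
  have "(\<lambda>n. measure_pmf.prob (P n) {w. Z n w \<ge> L + e} + measure_pmf.prob (P n) {w. Z n w \<le> L - e}) \<longlonglongrightarrow> 0"
    using tendsto_add[OF upper[OF e(1)] lower[OF e(1)]] by simp
  from tendsto_sandwich[OF always_eventually always_eventually tendsto_const this, of "\<lambda>n. measure_pmf.prob (P n) {w. Z n w \<notin> S}"]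
  show "(\<lambda>n. measure_pmf.prob (P n) {w. Z n w \<notin> S}) \<longlonglongrightarrow> 0"
    using bound by simp
qed

text \<open>The seed length is of the order of \<open>slack n\<close>, hence sublinear, and on the
  support the divergence is squeezed between 0 and
  \<open>log 2 ((1 + tol n)\<^sup>2)\<close>.\<close>

lemma universal_covert_code_spec:
  fixes C :: "nat \<Rightarrow> ('x::finite, 'y::finite) covert_code"
  assumes code: "\<And>n. is_code n (C n)" and spec: "\<forall>\<^sub>F n in sequentially. code_spec q n (C n)"
  shows "universal_covert q C"
  unfolding universal_covert_def
proof (intro conjI allI code)
  let ?c = "real CARD('x)"
  have bound: "\<forall>\<^sub>F n in sequentially. real (seed_length (C n)) / real n \<le>
      (?c * log 2 (real n + 1) + 1 + 2 * (3 * slack n + 1)) / real n"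
    using spec
  proof eventually_elim
    case (elim n)
    have "slack n \<ge> 0" by (simp add: slack_def)
    then have "seed_bits n \<le> 3 * slack n + 1" unfolding seed_bits_def by linarith
    then show ?case
      using elim type_bits_bounds(2)[of "CARD('x)" n]
      by (intro divide_right_mono) (auto simp: code_spec_def)
  qed
  have "(\<lambda>n. (?c * log 2 (real n + 1) + 1 + 2 * (3 * slack n + 1)) / real n) \<longlonglongrightarrow> 0"
    unfolding slack_def by real_asymp
  from tendsto_sandwich[OF always_eventually bound tendsto_const this]
  show "(\<lambda>n. real (seed_length (C n)) / real n) \<longlonglongrightarrow> 0" by simp
next
  fix p :: "'x pmf"
  show "(\<lambda>n. error_prob n p (C n)) \<longlonglongrightarrow> 0"
    by (rule tendsto_eventually) (use spec in \<open>auto simp: code_spec_def elim: eventually_mono\<close>)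
  show "p_lim (\<lambda>n. replicate_pmf n p) (\<lambda>n. covertness n p q (C n)) 0"
    unfolding p_lim_def
  proof (intro allI impI)
    fix S :: "ereal set" assume "open S" "0 \<in> S"
    then obtain a b where ab: "a < 0" "0 < b" "{a<..<b} \<subseteq> S"
      using ereal_open_cont_interval2[of S 0] by auto
    have "(\<lambda>n. log 2 ((1 + tol n)\<^sup>2)) \<longlonglongrightarrow> 0" unfolding tol_def by real_asymp
    then have "(\<lambda>n. ereal (log 2 ((1 + tol n)\<^sup>2))) \<longlonglongrightarrow> ereal 0" by (rule tendsto_ereal)
    then have "\<forall>\<^sub>F n in sequentially. ereal (log 2 ((1 + tol n)\<^sup>2)) < b"
      by (rule order_tendstoD(2)) (use ab(2) in \<open>simp add: zero_ereal_def\<close>)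
    with spec have "\<forall>\<^sub>F n in sequentially.
        measure_pmf.prob (replicate_pmf n p) {x. covertness n p q (C n) x \<notin> S} = 0"
    proof eventually_elim
      case (elim n)
      have "covertness n p q (C n) x \<in> S" if x: "x \<in> set_pmf (replicate_pmf n p)" for x
      proof -
        have "covertness n p q (C n) x < b" using elim x by (fastforce simp: code_spec_def intro: le_less_trans)
        moreover have "covertness n p q (C n) x \<ge> 0"
          unfolding covertness_def by (rule KL_div_nonneg[OF finite_set_output_pmf[OF x]])
        then have "covertness n p q (C n) x > a" using ab(1) by (rule less_le_trans[rotated])
        ultimately show ?thesis using ab(3) by auto
      qed
      then show ?case by (subst measure_pmf.prob_eq_0) (auto simp: AE_measure_pmf_iff)
    qed
    then show "(\<lambda>n. measure_pmf.prob (replicate_pmf n p) {x. covertness n p q (C n) x \<notin> S}) \<longlonglongrightarrow> 0"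
      by (rule tendsto_eventually)
  qed
qed

text \<open>The lower tail is the converse applied to this very code. For the upper tail, output
  length times \<open>?h\<close> exceeds the self-information of the source word by at most a
  sublinear term, so too long an output makes the source word atypical.\<close>

lemma length_rate_code_spec:
  fixes C :: "nat \<Rightarrow> ('x::finite, 'y::finite) covert_code"
  assumes h: "shannon_entropy q > 0" and uc: "universal_covert q C"
    and spec: "\<forall>\<^sub>F n in sequentially. code_spec q n (C n)"
  shows "p_lim (\<lambda>n. replicate_pmf n p) (length_rate C) (shannon_entropy p / shannon_entropy q)"
proof (rule p_limI_real)
  let ?H = "shannon_entropy p" and ?h = "shannon_entropy q" and ?P = "\<lambda>n. replicate_pmf n p"
  fix e :: real assume e: "e > 0"
  show "(\<lambda>n. measure_pmf.prob (?P n) {x. length_rate C n x \<le> ?H / ?h - e}) \<longlonglongrightarrow> 0"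
  proof (cases "?H / ?h - e \<ge> 0")
    case True
    have "(?H / ?h - e) * ?h < ?H" using e h by (simp add: left_diff_distrib)
    from short_outputs_vanish[OF uc True this]
    show ?thesis
      by (rule Lim_transform_eventually)
        (use eventually_gt_at_top[of 0] in eventually_elim, auto simp: length_rate_def pos_divide_le_eq)
  next
    case False
    have "{x. length_rate C n x \<le> ?H / ?h - e} = {}" for n
    proof -
      have "length_rate C n x \<ge> 0" for x by (simp add: length_rate_def)
      then have "\<not> length_rate C n x \<le> ?H / ?h - e" for x using False by (meson order_trans)
      then show ?thesis by blast
    qed
    then show ?thesis by simp
  qed
  \<comment> \<open>Half of the excess \<open>e * ?h\<close> absorbs the sublinear term, the other
    half is left as the deviation of the self-information.\<close>
  define \<delta> where "\<delta> = e * ?h / 2"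
  have \<delta>: "\<delta> > 0" using e h by (simp add: \<delta>_def)
  \<comment> \<open>The type bits together with the slack and the rounding of both blocks.\<close>
  define o_term where "o_term n = real CARD('x) * log 2 (real n + 1) + 1 + 2 * (slack n + 1 + ?h)" for n :: nat
  have "\<forall>\<^sub>F n in sequentially. o_term n < \<delta> * n"
    unfolding o_term_def slack_def using \<delta> by real_asymp
  with spec have bound: "\<forall>\<^sub>F n in sequentially. measure_pmf.prob (?P n) {x. length_rate C n x \<ge> ?H / ?h + e} \<le>
      n * info_variance p / (\<delta> * n)\<^sup>2"
    using eventually_gt_at_top[of 0]
  proof eventually_elim
    case (elim n)
    let ?a = "type_bits CARD('x) n" and ?M = "\<lambda>x :: 'x list. card (permutations_of_multiset (mset x))"
    have "\<bar>info (?P n) x - n * ?H\<bar> \<ge> \<delta> * n"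
      if x: "x \<in> set_pmf (?P n)" and r: "length_rate C n x \<ge> ?H / ?h + e" for x
    proof -
      have "n * ?H + 2 * \<delta> * n = (?H / ?h + e) * n * ?h" using h by (simp add: \<delta>_def field_simps)
      also have "\<dots> \<le> length_rate C n x * n * ?h"
        using r h by (intro mult_right_mono) auto
      also have "\<dots> = out_length (C n) x * ?h" using elim by (simp add: length_rate_def)
      also have "\<dots> = block_length ?h n (2 ^ ?a) * ?h + block_length ?h n (?M x) * ?h"
        using elim by (simp add: code_spec_def distrib_right)
      also have "\<dots> \<le> (log 2 (real (2 ^ ?a)) + slack n + 1 + ?h) + (log 2 (?M x) + slack n + 1 + ?h)"
        by (intro add_mono block_length_bounds h permutations_of_multiset_pos) simp
      also have "log 2 (real (2 ^ ?a)) = ?a" by simp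
      also have "real ?a \<le> real CARD('x) * log 2 (real n + 1) + 1" by (rule type_bits_bounds)
      also have "log 2 (?M x) \<le> info (?P n) x" by (rule log_card_class_le_info[OF x])
      finally have "n * ?H + 2 * \<delta> * n \<le> info (?P n) x + o_term n" by (simp add: o_term_def)
      then show ?thesis using elim(2) by simp
    qed
    then have "measure_pmf.prob (?P n) {x. length_rate C n x \<ge> ?H / ?h + e} \<le>
        measure_pmf.prob (?P n) {x. \<bar>info (?P n) x - n * ?H\<bar> \<ge> \<delta> * n}"
      by (intro measure_pmf.finite_measure_mono_AE) (auto simp: AE_measure_pmf_iff)
    also have "\<dots> \<le> n * info_variance p / (\<delta> * n)\<^sup>2"
      by (rule info_concentration) (use \<delta> elim in simp)
    finally show ?case .
  qed
  have "(\<lambda>n. n * info_variance p / (\<delta> * real n)\<^sup>2) \<longlonglongrightarrow> 0"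
    using \<delta> info_variance_nonneg[of p] by real_asymp
  from tendsto_sandwich[OF always_eventually bound tendsto_const this]
  show "(\<lambda>n. measure_pmf.prob (?P n) {x. length_rate C n x \<ge> ?H / ?h + e}) \<longlonglongrightarrow> 0"
    by simp
qed

section \<open>Attainment and optimality combined\<close>

theorem proposition2:
  fixes pY :: "'y::finite pmf"
  assumes "shannon_entropy pY > 0"
  shows "(\<exists>C :: nat \<Rightarrow> ('x::finite, 'y) covert_code. universal_covert pY C \<and>
            (\<forall>pX. \<exists>L. p_lim (\<lambda>n. replicate_pmf n pX) (length_rate C) L \<and>
                      L \<le> shannon_entropy pX / shannon_entropy pY)) \<and>
         (\<forall>(pX :: 'x pmf) R. achievable pX pY R \<longrightarrow>
            R \<ge> shannon_entropy pX / shannon_entropy pY)"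
proof (intro conjI allI impI)
  \<comment> \<open>A placeholder for the finitely many \<open>n\<close> for which the construction
    may not be available: \<open>universal_covert\<close> asks for a code at every \<open>n\<close>,
    but its limits ignore these.\<close>
  define trivial :: "nat \<Rightarrow> ('x, 'y) covert_code" where
    "trivial n = \<lparr>seed_length = 0, out_length = (\<lambda>_. 0), encode = (\<lambda>_ _. []),
       decode = (\<lambda>_ _. replicate n undefined)\<rparr>" for n
  have "\<forall>n. \<exists>C :: ('x, 'y) covert_code. is_code n C \<and> ((\<exists>C' :: ('x, 'y) covert_code. code_spec pY n C') \<longrightarrow> code_spec pY n C)"
  proof
    fix n
    have "is_code n (trivial n)" by (simp add: is_code_def trivial_def)
    then show "\<exists>C :: ('x, 'y) covert_code. is_code n C \<and> ((\<exists>C' :: ('x, 'y) covert_code. code_spec pY n C') \<longrightarrow> code_spec pY n C)"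
      unfolding code_spec_def by blast
  qed
  then obtain C :: "nat \<Rightarrow> ('x, 'y) covert_code" where code: "\<And>n. is_code n (C n)"
    and "\<And>n. (\<exists>C' :: ('x, 'y) covert_code. code_spec pY n C') \<Longrightarrow> code_spec pY n (C n)"
    by metis
  then have spec: "\<forall>\<^sub>F n in sequentially. code_spec pY n (C n)"
    by (intro eventually_mono[OF eventually_code_spec[OF assms, where 'x = 'x]])
  note uc = universal_covert_code_spec[OF code spec]
  show "\<exists>C :: nat \<Rightarrow> ('x, 'y) covert_code. universal_covert pY C \<and>
            (\<forall>pX. \<exists>L. p_lim (\<lambda>n. replicate_pmf n pX) (length_rate C) L \<and>
                      L \<le> shannon_entropy pX / shannon_entropy pY)"
    using uc length_rate_code_spec[OF assms uc spec] by blast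
next
  fix pX :: "'x pmf" and R
  assume "achievable pX pY R"
  with assms show "R \<ge> shannon_entropy pX / shannon_entropy pY" by (rule achievable_rate_ge)
qed

end
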